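(* Let $E$ and $F$ be countable graphs with no sinks and no sources. If the edge shifts $X_E$ and $X_F$ are conjugate, then the graph groupoids $\mathcal{G}_E$ and $\mathcal{G}_F$ are isomorphic as topological groupoids.
   Context: Graphs. A countable graph $E=(E^0,E^1,r,s)$ consists of countable sets $E^0$ (vertices), $E^1$ (edges) and range and source maps $r,s:E^1\to E^0$. A vertex $v$ is a sink if $s^{-1}(v)=\emptyset$, a source if $r^{-1}(v)=\emptyset$, and an infinite emitter if $s^{-1}(v)$ is infinite. A path of length $n\ge1$ is $\alpha=e_1\ldots e_n$ with $r(e_i)=s(e_{i+1})$; $E^n$ is the set of these; vertices are paths of length $0$; $r,s$ extend by $r(\alpha)=r(e_n)$, $s(\alpha)=s(e_1)$, and $r(v)=s(v)=v$ for vertices. $E^\infty$ is the set of infinite paths $e_1e_2\ldots$, with $s(e_1e_2\ldots)=s(e_1)$. $l$ denotes length. Edge shifts and conjugacy. For a set $\mathcal{A}$, let $\mathcal{A}^0=\{\vec{0}\}$ ($\vec{0}$ the empty sequence). If $\mathcal{A}$ is infinite, $\Sigma_{\mathcal{A}}:=\mathcal{A}^{\mathbb{N}}\sqcup\bigcup_{k\ge0}\mathcal{A}^k$ with the quotient topology from the map $Q:\mathcal{A}_\infty\times\mathcal{A}_\infty\times\cdots\to\Sigma_{\mathcal{A}}$ that truncates a sequence just before the first occurrence of $\infty$, where $\mathcal{A}_\infty=\mathcal{A}\cup\{\infty\}$ is the one-point compactification of the discrete space $\mathcal{A}$. If $\mathcal{A}$ is finite, $\Sigma_{\mathcal{A}}:=\mathcal{A}^{\mathbb{N}}$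 with the product topology. The shift map $\sigma$ deletes the first entry, with $\sigma(x)=\vec0$ when $l(x)\le1$. For a graph $E$ with no sinks, the edge shift $X_E$ is the closure of $E^\infty$ in $\Sigma_{E^1}$. $X_E$ and $X_F$ are conjugate ($X_E\cong X_F$) if there is a continuous bijection $\phi:X_E\to X_F$ with $\phi\circ\sigma=\sigma\circ\phi$ and $l(\phi(x))=l(x)$ for all $x$. Groupoids. For a graph $E$ with no sinks, the boundary path space is $\partial E:=E^\infty\cup\{\alpha\in\bigcup_{n=0}^\infty E^n:r(\alpha)\text{ is an infinite emitter}\}$. The graph groupoid is $\mathcal{G}_E:=\{(\alpha\gamma,l(\alpha)-l(\beta),\beta\gamma):\alpha,\beta\in\bigcup_{n=0}^\infty E^n,\ \gamma\in\partial E,\ r(\alpha)=r(\beta)=s(\gamma)\}$, with range $r(x,k,y)=y$, source $s(x,k,y)=x$, product $(x,k,y)\cdot(y,l,z)=(x,k+l,z)$ (elements $(x,k,y)$, $(y',l,z)$ are composable iff $y=y'$), and inverse $(x,k,y)^{-1}=(y,-k,x)$. Its topology is generated by the sets $Z(\alpha,\beta,F):=\{(\alpha\gamma,l(\alpha)-l(\beta),\beta\gamma):\gamma\in\partial E,\ s(\gamma)=v,\ \gamma_1\notin F\}$, where $\alpha,\beta\in\bigcup_{n=0}^\infty E^n$ with $r(\alpha)=r(\beta)=v$ and $F\subseteq E^1$ is finite (the condition $\gamma_1\notin F$ is vacuous if $l(\gamma)=0$). *)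

theory Defs
  imports "HOL-Analysis.Analysis" "Graph_Theory.Arc_Walk"
begin

section \<open>Graphs\<close>

text \<open>
  A graph (with loops and parallel edges allowed) is a \<open>pre_digraph\<close> that satisfies
  \<open>wf_digraph\<close>; the source map is \<open>tail\<close> and the range map is \<open>head\<close>.
\<close>

definition countable_graph :: "('v, 'e) pre_digraph \<Rightarrow> bool" where
  "countable_graph E \<longleftrightarrow> wf_digraph E \<and> countable (verts E) \<and> countable (arcs E)"

definition no_sinks :: "('v, 'e) pre_digraph \<Rightarrow> bool" where
  "no_sinks E \<longleftrightarrow> (\<forall>v \<in> verts E. out_arcs E v \<noteq> {})"

definition no_sources :: "('v, 'e) pre_digraph \<Rightarrow> bool" where
  "no_sources E \<longleftrightarrow> (\<forall>v \<in> verts E. in_arcs E v \<noteq> {})"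

definition infinite_emitter :: "('v, 'e) pre_digraph \<Rightarrow> 'v \<Rightarrow> bool" where
  "infinite_emitter E v \<longleftrightarrow> v \<in> verts E \<and> infinite (out_arcs E v)"


section \<open>Finite and infinite sequences\<close>

datatype 'a shift_seq = FinSeq "'a list" | InfSeq "nat \<Rightarrow> 'a"

fun seq_length :: "'a shift_seq \<Rightarrow> enat" where
  "seq_length (FinSeq xs) = enat (length xs)"
| "seq_length (InfSeq f) = \<infinity>"

fun seq_shift :: "'a shift_seq \<Rightarrow> 'a shift_seq" where
  "seq_shift (FinSeq xs) = FinSeq (tl xs)"
| "seq_shift (InfSeq f) = InfSeq (\<lambda>n. f (Suc n))"

fun seq_first :: "'a shift_seq \<Rightarrow> 'a option" where
  "seq_first (FinSeq xs) = (case xs of [] \<Rightarrow> None | x # _ \<Rightarrow> Some x)"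
| "seq_first (InfSeq f) = Some (f 0)"

fun seq_prepend :: "'a list \<Rightarrow> 'a shift_seq \<Rightarrow> 'a shift_seq" where
  "seq_prepend p (FinSeq xs) = FinSeq (p @ xs)"
| "seq_prepend p (InfSeq f) = InfSeq (\<lambda>n. if n < length p then p ! n else f (n - length p))"


section \<open>The full shift and edge shifts\<close>

definition quotient_topology :: "'a topology \<Rightarrow> ('a \<Rightarrow> 'b) \<Rightarrow> 'b topology" where
  "quotient_topology X q =
     topology (\<lambda>U. U \<subseteq> q ` topspace X \<and> openin X {x \<in> topspace X. q x \<in> U})"

lemma openin_quotient_topology:
  "openin (quotient_topology X q) U \<longleftrightarrow>
     U \<subseteq> q ` topspace X \<and> openin X {x \<in> topspace X. q x \<in> U}"
proof -
  have "istopology (\<lambda>U. U \<subseteq> q ` topspace X \<and> openin X {x \<in> topspace X. q x \<in> U})"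
    unfolding istopology_def
  proof (intro conjI allI impI)
    fix S T
    assume S: "S \<subseteq> q ` topspace X \<and> openin X {x \<in> topspace X. q x \<in> S}"
      and T: "T \<subseteq> q ` topspace X \<and> openin X {x \<in> topspace X. q x \<in> T}"
    show "S \<inter> T \<subseteq> q ` topspace X" using S by blast
    have eq: "{x \<in> topspace X. q x \<in> S \<inter> T} =
          {x \<in> topspace X. q x \<in> S} \<inter> {x \<in> topspace X. q x \<in> T}" by blast
    show "openin X {x \<in> topspace X. q x \<in> S \<inter> T}"
      unfolding eq by (rule openin_Int) (use S T in simp_all)
  next
    fix \<K>
    assume K: "\<forall>K\<in>\<K>. K \<subseteq> q ` topspace X \<and> openin X {x \<in> topspace X. q x \<in> K}"
    show "\<Union>\<K> \<subseteq> q ` topspace X" using K by blast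
    have eq: "{x \<in> topspace X. q x \<in> \<Union>\<K>} = (\<Union>K\<in>\<K>. {x \<in> topspace X. q x \<in> K})" by blast
    show "openin X {x \<in> topspace X. q x \<in> \<Union>\<K>}"
      unfolding eq by (rule openin_Union) (use K in auto)
  qed
  then show ?thesis by (simp add: quotient_topology_def)
qed

lemma topspace_quotient_topology [simp]:
  "topspace (quotient_topology X q) = q ` topspace X"
proof
  show "topspace (quotient_topology X q) \<subseteq> q ` topspace X"
    using openin_topspace[of "quotient_topology X q"] unfolding openin_quotient_topology
    by (rule conjunct1)
  have "{x \<in> topspace X. q x \<in> q ` topspace X} = topspace X" by blast
  then have "openin (quotient_topology X q) (q ` topspace X)"
    by (simp add: openin_quotient_topology)
  then show "q ` topspace X \<subseteq> topspace (quotient_topology X q)"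
    by (rule openin_subset)
qed

lemma quotient_map_quotient_topology: "quotient_map X (quotient_topology X q) q"
  by (auto simp: quotient_map_def openin_quotient_topology)

text \<open>In the one-point compactification the point at infinity is \<open>None\<close>.\<close>

definition truncate_seq :: "(nat \<Rightarrow> 'a option) \<Rightarrow> 'a shift_seq" where
  "truncate_seq x =
     (if \<exists>n. x n = None
      then FinSeq (map (\<lambda>i. the (x i)) [0..<(LEAST n. x n = None)])
      else InfSeq (\<lambda>n. the (x n)))"

text \<open>
  For finite \<open>A\<close> the quotient map is the injection \<open>InfSeq\<close>, so the full shift is homeomorphic
  to the product space of infinite sequences and contains no finite sequences.
\<close>

definition full_shift :: "'a set \<Rightarrow> 'a shift_seq topology" where
  "full_shift A =
     (if finite A
      then quotient_topology (product_topology (\<lambda>_. discrete_topology A) UNIV) InfSeq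
      else quotient_topology
             (product_topology (\<lambda>_. Alexandroff_compactification (discrete_topology A)) UNIV)
             truncate_seq)"

definition infinite_paths :: "('v, 'e) pre_digraph \<Rightarrow> (nat \<Rightarrow> 'e) set" where
  "infinite_paths E = {f. \<forall>n. f n \<in> arcs E \<and> head E (f n) = tail E (f (Suc n))}"

definition edge_shift :: "('v, 'e) pre_digraph \<Rightarrow> 'e shift_seq set" where
  "edge_shift E = full_shift (arcs E) closure_of (InfSeq ` infinite_paths E)"

definition edge_shift_topology :: "('v, 'e) pre_digraph \<Rightarrow> 'e shift_seq topology" where
  "edge_shift_topology E = subtopology (full_shift (arcs E)) (edge_shift E)"

definition edge_shifts_conjugate ::
    "('v, 'e) pre_digraph \<Rightarrow> ('w, 'f) pre_digraph \<Rightarrow> bool" where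
  "edge_shifts_conjugate E F \<longleftrightarrow>
     (\<exists>\<phi>. bij_betw \<phi> (edge_shift E) (edge_shift F) \<and>
          continuous_map (edge_shift_topology E) (edge_shift_topology F) \<phi> \<and>
          (\<forall>x \<in> edge_shift E. \<phi> (seq_shift x) = seq_shift (\<phi> x)) \<and>
          (\<forall>x \<in> edge_shift E. seq_length (\<phi> x) = seq_length x))"


section \<open>Boundary paths\<close>

text \<open>
  A path is encoded as the pair of its source vertex and its sequence of edges. Thus the vertex
  \<open>v\<close> as a path of length 0 is \<open>(v, FinSeq [])\<close>, and distinct vertices are distinct paths;
  for paths of positive length the first component is redundant. A finite path from \<open>v\<close>
  to \<open>w\<close> with edge list \<open>p\<close> is given by \<open>pre_digraph.awalk E v p w\<close>.
\<close>

type_synonym ('v, 'e) path = "'v \<times> 'e shift_seq"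

definition boundary_paths :: "('v, 'e) pre_digraph \<Rightarrow> ('v, 'e) path set" where
  "boundary_paths E =
     {(tail E (f 0), InfSeq f) | f. f \<in> infinite_paths E} \<union>
     {(v, FinSeq p) | v p w. pre_digraph.awalk E v p w \<and> infinite_emitter E w}"


section \<open>Topological groupoids\<close>

text \<open>
  The underlying set of the groupoid is the \<open>topspace\<close> of the arrow topology. The operations are
  only meaningful on arrows, and the product only on composable pairs of arrows.
\<close>

record 'g topological_groupoid =
  arrow_topology :: "'g topology"
  composable :: "'g \<Rightarrow> 'g \<Rightarrow> bool"
  arrow_mult :: "'g \<Rightarrow> 'g \<Rightarrow> 'g"
  arrow_inverse :: "'g \<Rightarrow> 'g"

abbreviation arrows :: "'g topological_groupoid \<Rightarrow> 'g set" where
  "arrows G \<equiv> topspace (arrow_topology G)"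

definition topological_groupoid_iso ::
    "'g topological_groupoid \<Rightarrow> 'h topological_groupoid \<Rightarrow> ('g \<Rightarrow> 'h) \<Rightarrow> bool" where
  "topological_groupoid_iso G H \<Phi> \<longleftrightarrow>
     homeomorphic_map (arrow_topology G) (arrow_topology H) \<Phi> \<and>
     (\<forall>g \<in> arrows G. \<forall>h \<in> arrows G. composable G g h \<longleftrightarrow> composable H (\<Phi> g) (\<Phi> h)) \<and>
     (\<forall>g \<in> arrows G. \<forall>h \<in> arrows G. composable G g h \<longrightarrow>
        \<Phi> (arrow_mult G g h) = arrow_mult H (\<Phi> g) (\<Phi> h)) \<and>
     (\<forall>g \<in> arrows G. \<Phi> (arrow_inverse G g) = arrow_inverse H (\<Phi> g))"

definition isomorphic_topological_groupoids ::
    "'g topological_groupoid \<Rightarrow> 'h topological_groupoid \<Rightarrow> bool" where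
  "isomorphic_topological_groupoids G H \<longleftrightarrow> (\<exists>\<Phi>. topological_groupoid_iso G H \<Phi>)"


section \<open>The graph groupoid\<close>

type_synonym ('v, 'e) graph_arrow = "('v, 'e) path \<times> int \<times> ('v, 'e) path"

text \<open>Here \<open>\<alpha> = (u, p)\<close>, \<open>\<beta> = (v, q)\<close>, \<open>\<gamma> = (w, z)\<close>, and \<open>w\<close> is the common range of
  \<open>\<alpha>\<close> and \<open>\<beta>\<close>.\<close>

definition graph_groupoid_arrows :: "('v, 'e) pre_digraph \<Rightarrow> ('v, 'e) graph_arrow set" where
  "graph_groupoid_arrows E =
     {((u, seq_prepend p z), int (length p) - int (length q), (v, seq_prepend q z)) | u p v q w z.
        pre_digraph.awalk E u p w \<and> pre_digraph.awalk E v q w \<and> (w, z) \<in> boundary_paths E}"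

text \<open>\<open>groupoid_cylinder E u p v q w S\<close> is the basic set \<open>Z(\<alpha>, \<beta>, S)\<close>.\<close>

definition groupoid_cylinder ::
    "('v, 'e) pre_digraph \<Rightarrow> 'v \<Rightarrow> 'e list \<Rightarrow> 'v \<Rightarrow> 'e list \<Rightarrow> 'v \<Rightarrow> 'e set
       \<Rightarrow> ('v, 'e) graph_arrow set" where
  "groupoid_cylinder E u p v q w S =
     {((u, seq_prepend p z), int (length p) - int (length q), (v, seq_prepend q z)) | z.
        (w, z) \<in> boundary_paths E \<and> (\<forall>e. seq_first z = Some e \<longrightarrow> e \<notin> S)}"

definition groupoid_basis :: "('v, 'e) pre_digraph \<Rightarrow> ('v, 'e) graph_arrow set set" where
  "groupoid_basis E =
     {groupoid_cylinder E u p v q w S | u p v q w S.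
        pre_digraph.awalk E u p w \<and> pre_digraph.awalk E v q w \<and> finite S \<and> S \<subseteq> arcs E}"

text \<open>Note the convention: the range of \<open>(x, k, y)\<close> is \<open>y\<close> and its source is \<open>x\<close>.\<close>

fun graph_arrow_source :: "('v, 'e) graph_arrow \<Rightarrow> ('v, 'e) path" where
  "graph_arrow_source (x, k, y) = x"

fun graph_arrow_range :: "('v, 'e) graph_arrow \<Rightarrow> ('v, 'e) path" where
  "graph_arrow_range (x, k, y) = y"

fun graph_arrow_mult ::
    "('v, 'e) graph_arrow \<Rightarrow> ('v, 'e) graph_arrow \<Rightarrow> ('v, 'e) graph_arrow" where
  "graph_arrow_mult (x, k, y) (y', l, z) = (x, k + l, z)"

fun graph_arrow_inverse :: "('v, 'e) graph_arrow \<Rightarrow> ('v, 'e) graph_arrow" where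
  "graph_arrow_inverse (x, k, y) = (y, - k, x)"

definition graph_groupoid ::
    "('v, 'e) pre_digraph \<Rightarrow> ('v, 'e) graph_arrow topological_groupoid" where
  "graph_groupoid E =
     \<lparr> arrow_topology = topology_generated_by (groupoid_basis E),
       composable = (\<lambda>g h. graph_arrow_range g = graph_arrow_source h),
       arrow_mult = graph_arrow_mult,
       arrow_inverse = graph_arrow_inverse \<rparr>"

lemma arrows_graph_groupoid: "arrows (graph_groupoid E) = graph_groupoid_arrows E"
proof
  have "groupoid_cylinder E u p v q w S \<subseteq> graph_groupoid_arrows E"
    if "pre_digraph.awalk E u p w" "pre_digraph.awalk E v q w" for u p v q w S
    unfolding groupoid_cylinder_def graph_groupoid_arrows_def using that by blast
  then have "\<Union>(groupoid_basis E) \<subseteq> graph_groupoid_arrows E"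
    unfolding groupoid_basis_def by (intro Union_least) (elim CollectE exE conjE, simp)
  then show "arrows (graph_groupoid E) \<subseteq> graph_groupoid_arrows E"
    by (simp add: graph_groupoid_def topology_generated_by_topspace)
  show "graph_groupoid_arrows E \<subseteq> arrows (graph_groupoid E)"
  proof
    fix g assume "g \<in> graph_groupoid_arrows E"
    then obtain u p v q w z where
      g: "g = ((u, seq_prepend p z), int (length p) - int (length q), (v, seq_prepend q z))"
      and wz: "pre_digraph.awalk E u p w" "pre_digraph.awalk E v q w" "(w, z) \<in> boundary_paths E"
      unfolding graph_groupoid_arrows_def by blast
    have "g \<in> groupoid_cylinder E u p v q w {}"
      using g wz unfolding groupoid_cylinder_def by blast
    moreover have "groupoid_cylinder E u p v q w {} \<in> groupoid_basis E"
      using wz unfolding groupoid_basis_def by blast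
    ultimately have "g \<in> \<Union>(groupoid_basis E)"
      by (rule UnionI[rotated])
    then show "g \<in> arrows (graph_groupoid E)"
      by (simp add: graph_groupoid_def topology_generated_by_topspace)
  qed
qed

end

theory Submission
  imports Defs
begin

text \<open>
  A conjugacy \<open>\<phi>\<close> between the edge shifts lifts to a shift-commuting homeomorphism between the
  boundary path spaces, and acting with this lift on both ends of an arrow is an isomorphism of the
  graph groupoids. The only boundary paths that the edge shift does not see are the infinite
  emitters, which it collapses to the empty sequence. An infinite emitter \<open>v\<close> is sent to the
  range of \<open>\<phi> e\<close> for an edge \<open>e\<close> with range \<open>v\<close>, which exists since there are no
  sources. Continuity of \<open>\<phi>\<close> at \<open>e\<close> makes this range independent of the choice
  of \<open>e\<close>. The inverse of \<open>\<phi>\<close> is again a conjugacy because edge shifts are compact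
  Hausdorff spaces, so that every step can be applied to it as well.
\<close>

section \<open>Prefixes of sequences\<close>

text \<open>No map of edges lies behind a conjugacy: the first edge of \<open>\<phi> (e x)\<close>
  may depend on all of \<open>e x\<close>, so a cylinder \<open>Z(\<alpha>, \<beta>, S)\<close> need
  not be sent to a cylinder, and continuity of the groupoid map has to be checked at each arrow.
  What survives is that \<open>\<phi> (e x)\<close> is one edge followed by \<open>\<phi> x\<close>.
  Hence a prefix is replaced by one of the same length, and the integer of an arrow is kept. Open
  sets are described by having or not having a given prefix. This description is the same for finite
  and infinite alphabets, although the two full shifts are defined differently. It also matches the
  basis of the groupoid, where a forbidden first edge is a forbidden prefix.\<close>

definition seq_prefix :: "'a list \<Rightarrow> 'a shift_seq \<Rightarrow> bool" where
  "seq_prefix p y \<longleftrightarrow> (\<exists>z. y = seq_prepend p z)"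

lemma seq_prepend_Nil [simp]: "seq_prepend [] z = z"
  by (cases z) auto

lemma seq_prepend_append: "seq_prepend p (seq_prepend q z) = seq_prepend (p @ q) z"
  by (cases z) (auto simp: fun_eq_iff nth_append)

lemma seq_prepend_Cons: "seq_prepend (e # p) z = seq_prepend [e] (seq_prepend p z)"
  by (simp add: seq_prepend_append)

lemma seq_shift_Cons [simp]: "seq_shift (seq_prepend [e] z) = z"
  by (cases z) auto

lemma seq_first_Cons [simp]: "seq_first (seq_prepend [e] z) = Some e"
  by (cases z) auto

lemma seq_length_Cons [simp]: "seq_length (seq_prepend [e] z) = eSuc (seq_length z)"
  by (cases z) (auto simp: eSuc_enat)

lemma seq_length_eq_0 [simp]: "seq_length y = 0 \<longleftrightarrow> y = FinSeq []"
  by (cases y) (auto simp: zero_enat_def)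

lemma seq_prepend_Cons_eq [simp]:
  "seq_prepend [e] z = seq_prepend [f] z' \<longleftrightarrow> e = f \<and> z = z'"
  by (metis seq_shift_Cons seq_first_Cons option.inject)

lemma seq_prepend_Cons_neq_Nil [simp]:
  "seq_prepend [e] z \<noteq> FinSeq []" "FinSeq [] \<noteq> seq_prepend [e] z"
  by (cases z; simp)+

lemma seq_prepend_inject [simp]: "seq_prepend p z = seq_prepend p z' \<longleftrightarrow> z = z'"
  by (induction p) (simp, metis seq_prepend_Cons seq_prepend_Cons_eq)

lemma shift_seq_cases [case_names Nil Cons]:
  obtains "y = FinSeq []" | e z where "y = seq_prepend [e] z"
proof (cases y)
  case (FinSeq xs)
  then show ?thesis
    by (cases xs) (auto intro: that(1) that(2)[of _ "FinSeq (tl xs)"])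
next
  case (InfSeq f)
  then have "y = seq_prepend [f 0] (InfSeq (\<lambda>n. f (Suc n)))"
    by (auto simp: fun_eq_iff)
  then show ?thesis by (rule that(2))
qed

lemma seq_first_eq_Some: "seq_first y = Some e \<longleftrightarrow> (\<exists>z. y = seq_prepend [e] z)"
  by (cases y rule: shift_seq_cases) auto

lemma seq_prefix_Nil [simp]: "seq_prefix [] y"
  by (simp add: seq_prefix_def)

lemma seq_prefix_prepend [simp]: "seq_prefix p (seq_prepend p z)"
  by (auto simp: seq_prefix_def)

lemma seq_prefix_Cons_Nil [simp]: "\<not> seq_prefix (a # p) (FinSeq [])"
  unfolding seq_prefix_def by (metis seq_prepend_Cons seq_prepend_Cons_neq_Nil)

lemma seq_prefix_Cons_Cons [simp]:
  "seq_prefix (a # p) (seq_prepend [b] z) \<longleftrightarrow> a = b \<and> seq_prefix p z"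
  unfolding seq_prefix_def by (metis seq_prepend_Cons seq_prepend_Cons_eq)

lemma seq_prefix_append_prepend [simp]:
  "seq_prefix (q @ p) (seq_prepend q z) \<longleftrightarrow> seq_prefix p z"
proof (induction q)
  case (Cons a q)
  then show ?case by (subst seq_prepend_Cons) simp
qed simp

lemma seq_prefix_FinSeq: "seq_prefix p (FinSeq xs) \<longleftrightarrow> (\<exists>ys. xs = p @ ys)"
proof
  assume "seq_prefix p (FinSeq xs)"
  then obtain z where z: "FinSeq xs = seq_prepend p z"
    by (auto simp: seq_prefix_def)
  then show "\<exists>ys. xs = p @ ys" by (cases z) auto
next
  assume "\<exists>ys. xs = p @ ys"
  then obtain ys where "xs = p @ ys" ..
  then have "FinSeq xs = seq_prepend p (FinSeq ys)" by simp
  then show "seq_prefix p (FinSeq xs)" unfolding seq_prefix_def by blast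
qed

lemma seq_prefix_InfSeq: "seq_prefix p (InfSeq f) \<longleftrightarrow> (\<forall>i<length p. f i = p ! i)"
proof
  assume "seq_prefix p (InfSeq f)"
  then obtain z where z: "InfSeq f = seq_prepend p z"
    by (auto simp: seq_prefix_def)
  then show "\<forall>i<length p. f i = p ! i" by (cases z) auto
next
  assume "\<forall>i<length p. f i = p ! i"
  then have "InfSeq f = seq_prepend p (InfSeq (\<lambda>n. f (n + length p)))"
    by auto
  then show "seq_prefix p (InfSeq f)" unfolding seq_prefix_def by blast
qed

lemma seq_prefix_map_upt: "seq_prefix (map f [0..<n]) (InfSeq f)"
  by (simp add: seq_prefix_InfSeq)

lemma seq_prefix_appendD: "seq_prefix (p @ q) y \<Longrightarrow> seq_prefix p y"
  unfolding seq_prefix_def by (metis seq_prepend_append)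

lemma seq_prefix_same_length:
  assumes "seq_prefix r (seq_prepend q z)" "length q = length r"
  shows "q = r"
  using assms
proof (induction q arbitrary: r)
  case (Cons a q)
  then obtain b r' where "r = b # r'" by (cases r) auto
  then show ?case using Cons by (simp add: seq_prepend_Cons[of a q])
qed simp

text \<open>Take for \<open>q\<close> the longest initial part of \<open>p\<close> that
  \<open>y\<close> follows. Failing to have a prefix thus becomes following a word and then avoiding
  one letter, which is the form of a cylinder with a forbidden first edge.\<close>

lemma not_seq_prefix_decompose:
  assumes "\<not> seq_prefix p y"
  obtains q a r where "p = q @ a # r" "seq_prefix q y" "\<not> seq_prefix (q @ [a]) y"
  using assms
proof (induction p arbitrary: thesis rule: rev_induct)
  case Nil
  then show ?case by simp
next
  case (snoc x xs)
  show ?case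
  proof (cases "seq_prefix xs y")
    case True
    then show ?thesis using snoc.prems by blast
  next
    case False
    show ?thesis
      by (rule snoc.IH[OF _ False]) (rule snoc.prems(1), auto)
  qed
qed

text \<open>A finite sequence is told from an infinite one by a prefix one letter longer than the
  finite sequence. Because of this, prefix sets separate points.\<close>

lemma shift_seq_eqI:
  assumes "\<And>p. seq_prefix p x \<longleftrightarrow> seq_prefix p y"
  shows "x = y"
proof -
  have FI: False if "\<And>p. seq_prefix p (FinSeq xs) \<longleftrightarrow> seq_prefix p (InfSeq f)"
    for xs :: "'a list" and f
    using that[of "map f [0..<Suc (length xs)]"] seq_prefix_map_upt[of f "Suc (length xs)"]
    by (auto simp: seq_prefix_FinSeq dest: arg_cong[of _ _ length])
  show ?thesis
  proof (cases x)
    case x: (FinSeq xs)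
    show ?thesis
    proof (cases y)
      case (FinSeq ys)
      then show ?thesis
        using assms[of xs] assms[of ys] x by (auto simp: seq_prefix_FinSeq)
    next
      case (InfSeq g)
      then show ?thesis using FI[of xs g] assms x by blast
    qed
  next
    case x: (InfSeq f)
    show ?thesis
    proof (cases y)
      case (FinSeq ys)
      then show ?thesis using FI[of ys f] assms x by blast
    next
      case (InfSeq g)
      have "f n = g n" for n
      proof -
        have "seq_prefix (map f [0..<Suc n]) (InfSeq g)"
          using assms[of "map f [0..<Suc n]"] x InfSeq seq_prefix_map_upt by metis
        then have "g n = map f [0..<Suc n] ! n"
          unfolding seq_prefix_InfSeq by (metis diff_zero length_map length_upt lessI)
        also have "\<dots> = f n" by (subst nth_map) (auto simp del: upt_Suc)
        finally show ?thesis ..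
      qed
      then show ?thesis using x InfSeq by auto
    qed
  qed
qed

text \<open>If \<open>p\<close> reaches past the first \<open>None\<close>, both sides fail. Hence
  prefix sets pull back along truncation to plain cylinders of the product.\<close>

lemma seq_prefix_truncate_seq:
  "seq_prefix p (truncate_seq x) \<longleftrightarrow> (\<forall>i<length p. x i = Some (p ! i))"
proof (cases "\<exists>n. x n = None")
  case True
  define m where "m = (LEAST n. x n = None)"
  have m: "x m = None" unfolding m_def using True by (rule LeastI_ex)
  have lt: "\<exists>a. x i = Some a" if "i < m" for i
    using not_less_Least[of i "\<lambda>n. x n = None"] that by (auto simp: m_def)
  have t: "truncate_seq x = FinSeq (map (\<lambda>i. the (x i)) [0..<m])"
    using True by (simp add: truncate_seq_def m_def)
  show ?thesis
  proof
    assume "seq_prefix p (truncate_seq x)"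
    then obtain ys where ys: "map (\<lambda>i. the (x i)) [0..<m] = p @ ys"
      unfolding t seq_prefix_FinSeq by blast
    show "\<forall>i<length p. x i = Some (p ! i)"
    proof (intro allI impI)
      fix i assume i: "i < length p"
      have "m = length p + length ys" using arg_cong[OF ys, of length] by simp
      then have "i < m" using i by simp
      moreover have "the (x i) = p ! i"
        using arg_cong[OF ys, of "\<lambda>l. l ! i"] i \<open>i < m\<close> by (simp add: nth_append)
      ultimately show "x i = Some (p ! i)" using lt[of i] by auto
    qed
  next
    assume *: "\<forall>i<length p. x i = Some (p ! i)"
    then have "length p \<le> m" using m by (metis not_le option.distinct(1))
    then have "map (\<lambda>i. the (x i)) [0..<m] = p @ map (\<lambda>i. the (x i)) [length p..<m]"
      using * by (intro nth_equalityI) (auto simp: nth_append)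
    then show "seq_prefix p (truncate_seq x)" unfolding t seq_prefix_FinSeq by blast
  qed
next
  case False
  then have "the (x i) = a \<longleftrightarrow> x i = Some a" for i a by (metis option.collapse option.sel)
  moreover have "truncate_seq x = InfSeq (\<lambda>n. the (x n))"
    using False by (simp add: truncate_seq_def)
  ultimately show ?thesis by (simp add: seq_prefix_InfSeq)
qed


section \<open>The topology of the full shift\<close>

lemma topspace_full_shift_finite:
  "finite A \<Longrightarrow> topspace (full_shift A) = InfSeq ` {f. \<forall>n. f n \<in> A}"
  by (auto simp: full_shift_def PiE_def Pi_def)

lemma truncate_seq_in:
  assumes "\<And>n a. x n = Some a \<Longrightarrow> a \<in> A"
  shows "set_shift_seq (truncate_seq x) \<subseteq> A"
  using assms by (auto simp: truncate_seq_def dest!: not_less_Least)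

lemma topspace_full_shift_infinite:
  assumes "infinite A"
  shows "topspace (full_shift A) = {y. set_shift_seq y \<subseteq> A}"
proof -
  have "truncate_seq ` (UNIV \<rightarrow>\<^sub>E insert None (Some ` A)) = {y. set_shift_seq y \<subseteq> A}"
  proof (intro equalityI subsetI)
    fix y assume "y \<in> truncate_seq ` (UNIV \<rightarrow>\<^sub>E insert None (Some ` A))"
    then obtain x where x: "y = truncate_seq x" "\<And>n. x n \<in> insert None (Some ` A)"
      by auto
    then have "\<And>n a. x n = Some a \<Longrightarrow> a \<in> A" by (metis image_iff insertE option.distinct(1) option.inject)
    then show "y \<in> {y. set_shift_seq y \<subseteq> A}" using truncate_seq_in x(1) by blast
  next
    fix y assume y: "y \<in> {y. set_shift_seq y \<subseteq> A}"
    show "y \<in> truncate_seq ` (UNIV \<rightarrow>\<^sub>E insert None (Some ` A))"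
    proof (cases y)
      case (FinSeq xs)
      \<comment> \<open>Only the first \<open>None\<close> matters for truncation, so padding with
        \<open>None\<close> is one preimage among many.\<close>
      define x where "x n = (if n < length xs then Some (xs ! n) else None)" for n
      have "truncate_seq x = FinSeq xs"
      proof -
        have "(LEAST n. x n = None) = length xs"
          by (rule Least_equality) (auto simp: x_def split: if_splits)
        moreover have "map (\<lambda>i. the (x i)) [0..<length xs] = xs"
          by (rule nth_equalityI) (auto simp: x_def)
        moreover have "x (length xs) = None" by (simp add: x_def)
        ultimately show ?thesis unfolding truncate_seq_def by metis
      qed
      moreover have "x \<in> UNIV \<rightarrow>\<^sub>E insert None (Some ` A)"
        using y FinSeq by (auto simp: x_def subset_iff)
      ultimately show ?thesis using FinSeq by (metis image_eqI)
    next
      case (InfSeq f)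
      then have "y = truncate_seq (\<lambda>n. Some (f n))" by (simp add: truncate_seq_def)
      moreover have "(\<lambda>n. Some (f n)) \<in> UNIV \<rightarrow>\<^sub>E insert None (Some ` A)"
        using y InfSeq by auto
      ultimately show ?thesis by blast
    qed
  qed
  then show ?thesis using assms by (simp add: full_shift_def)
qed

lemma InfSeq_in_full_shift [simp]:
  "InfSeq f \<in> topspace (full_shift A) \<longleftrightarrow> (\<forall>n. f n \<in> A)"
  by (cases "finite A") (auto simp: topspace_full_shift_finite topspace_full_shift_infinite)

lemma FinSeq_in_full_shift [simp]:
  "FinSeq p \<in> topspace (full_shift A) \<longleftrightarrow> infinite A \<and> set p \<subseteq> A"
  by (cases "finite A") (auto simp: topspace_full_shift_finite topspace_full_shift_infinite)

lemma seq_prepend_in_full_shift [simp]: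
  "seq_prepend [e] z \<in> topspace (full_shift A) \<longleftrightarrow> e \<in> A \<and> z \<in> topspace (full_shift A)"
proof (cases z)
  case (InfSeq f)
  have "(\<forall>n. (if n < 1 then [e] ! n else f (n - 1)) \<in> A) \<longleftrightarrow> e \<in> A \<and> (\<forall>n. f n \<in> A)"
    (is "(\<forall>n. ?g n \<in> A) \<longleftrightarrow> _")
  proof -
    have "?g 0 = e" "?g (Suc n) = f n" for n by auto
    then show ?thesis by (metis not0_implies_Suc)
  qed
  moreover have "length [e] = 1" by simp
  ultimately show ?thesis unfolding InfSeq seq_prepend.simps InfSeq_in_full_shift by metis
qed auto

text \<open>The negated sets are essential at finite words: a neighbourhood of \<open>p\<close> may
  exclude finitely many continuations \<open>p @ [a]\<close>, which positive prefix sets cannot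
  express.\<close>

definition prefix_subbasis :: "'a set \<Rightarrow> 'a shift_seq set set" where
  "prefix_subbasis A =
     range (\<lambda>p. {y \<in> topspace (full_shift A). seq_prefix p y}) \<union>
     range (\<lambda>p. {y \<in> topspace (full_shift A). \<not> seq_prefix p y})"

section \<open>Prefix sets are clopen\<close>

lemma clopen_conj_less:
  fixes n :: nat
  assumes "\<And>i. i < n \<Longrightarrow>
    openin X {x \<in> topspace X. P i x} \<and> openin X {x \<in> topspace X. \<not> P i x}"
  shows "openin X {x \<in> topspace X. \<forall>i<n. P i x} \<and> openin X {x \<in> topspace X. \<not> (\<forall>i<n. P i x)}"
  using assms
proof (induction n)
  case (Suc n)
  have 1: "{x \<in> topspace X. \<forall>i<Suc n. P i x} =
      {x \<in> topspace X. \<forall>i<n. P i x} \<inter> {x \<in> topspace X. P n x}"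
    and 2: "{x \<in> topspace X. \<not> (\<forall>i<Suc n. P i x)} =
      {x \<in> topspace X. \<not> (\<forall>i<n. P i x)} \<union> {x \<in> topspace X. \<not> P n x}"
    by (auto simp: less_Suc_eq)
  show ?case unfolding 1 2 using Suc by (intro conjI openin_Int openin_Un) auto
qed auto

text \<open>Finite and infinite alphabets differ here only in the factor \<open>Y\<close>; all that
  is needed is that letters are clopen points of it. A letter \<open>c i\<close> may lie outside
  \<open>Y\<close>, hence the intersection with \<open>topspace Y\<close>.\<close>

lemma clopen_product_cylinder:
  fixes Y :: "'b topology"
  assumes "\<And>i. openin Y (topspace Y \<inter> {c i}) \<and> openin Y (topspace Y - {c i})"
  shows "openin (product_topology (\<lambda>_::nat. Y) UNIV)
           {x \<in> topspace (product_topology (\<lambda>_. Y) UNIV). \<forall>i<n. x i = c i} \<and>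
         openin (product_topology (\<lambda>_::nat. Y) UNIV)
           {x \<in> topspace (product_topology (\<lambda>_. Y) UNIV). \<not> (\<forall>i<n. x i = c i)}"
proof (rule clopen_conj_less, intro conjI)
  fix i :: nat
  let ?P = "product_topology (\<lambda>_::nat. Y) UNIV"
  have c: "continuous_map ?P Y (\<lambda>x. x i)"
    by (rule continuous_map_product_projection) simp
  have 1: "{x \<in> topspace ?P. x i = c i} = {x \<in> topspace ?P. x i \<in> topspace Y \<inter> {c i}}"
    and 2: "{x \<in> topspace ?P. x i \<noteq> c i} = {x \<in> topspace ?P. x i \<in> topspace Y - {c i}}"
    by auto
  show "openin ?P {x \<in> topspace ?P. x i = c i}"
    unfolding 1 by (rule openin_continuous_map_preimage[OF c]) (use assms in blast)
  show "openin ?P {x \<in> topspace ?P. x i \<noteq> c i}"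
    unfolding 2 by (rule openin_continuous_map_preimage[OF c]) (use assms in blast)
qed

text \<open>The complement of \<open>Some a\<close> is a neighbourhood of infinity because a single
  point is compact.\<close>

lemma clopen_Alexandroff_Some:
  "openin (Alexandroff_compactification (discrete_topology A))
     (topspace (Alexandroff_compactification (discrete_topology A)) \<inter> {Some a}) \<and>
   openin (Alexandroff_compactification (discrete_topology A))
     (topspace (Alexandroff_compactification (discrete_topology A)) - {Some a})"
proof
  show "openin (Alexandroff_compactification (discrete_topology A))
     (topspace (Alexandroff_compactification (discrete_topology A)) \<inter> {Some a})"
  proof -
    have "topspace (Alexandroff_compactification (discrete_topology A)) \<inter> {Some a} =
        Some ` (A \<inter> {a})" by auto
    moreover have "openin (discrete_topology A) (A \<inter> {a})" by simp
    ultimately show ?thesis unfolding openin_Alexandroff_compactification by blast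
  qed
  have "topspace (Alexandroff_compactification (discrete_topology A)) - {Some a} =
      insert None (Some ` (topspace (discrete_topology A) - A \<inter> {a}))" by auto
  moreover have "compactin (discrete_topology A) (A \<inter> {a})" by (simp add: compactin_discrete_topology)
  ultimately show "openin (Alexandroff_compactification (discrete_topology A))
      (topspace (Alexandroff_compactification (discrete_topology A)) - {Some a})"
    unfolding openin_Alexandroff_compactification
    by (intro disjI2 exI[of _ "A \<inter> {a}"]) auto
qed

lemma prefix_clopen:
  "openin (full_shift A) {y \<in> topspace (full_shift A). seq_prefix p y} \<and>
   openin (full_shift A) {y \<in> topspace (full_shift A). \<not> seq_prefix p y}"
proof (cases "finite A")
  case True
  let ?P = "product_topology (\<lambda>_::nat. discrete_topology A) UNIV"
  have *: "openin ?P {x \<in> topspace ?P. \<forall>i<length p. x i = p ! i} \<and>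
      openin ?P {x \<in> topspace ?P. \<not> (\<forall>i<length p. x i = p ! i)}"
    by (rule clopen_product_cylinder) auto
  have "{x \<in> topspace ?P. InfSeq x \<in> {y \<in> topspace (full_shift A). seq_prefix p y}} =
        {x \<in> topspace ?P. \<forall>i<length p. x i = p ! i}"
    and "{x \<in> topspace ?P. InfSeq x \<in> {y \<in> topspace (full_shift A). \<not> seq_prefix p y}} =
        {x \<in> topspace ?P. \<not> (\<forall>i<length p. x i = p ! i)}"
    by (auto simp: seq_prefix_InfSeq)
  with * show ?thesis using True
    by (auto simp: full_shift_def openin_quotient_topology)
next
  case False
  let ?P = "product_topology (\<lambda>_::nat. Alexandroff_compactification (discrete_topology A)) UNIV"
  have *: "openin ?P {x \<in> topspace ?P. \<forall>i<length p. x i = Some (p ! i)} \<and>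
      openin ?P {x \<in> topspace ?P. \<not> (\<forall>i<length p. x i = Some (p ! i))}"
    by (rule clopen_product_cylinder) (rule clopen_Alexandroff_Some)
  have T: "full_shift A = quotient_topology ?P truncate_seq"
    using False by (simp add: full_shift_def)
  have "{x \<in> topspace ?P. truncate_seq x \<in> {y \<in> topspace (full_shift A). seq_prefix p y}} =
        {x \<in> topspace ?P. \<forall>i<length p. x i = Some (p ! i)}"
    and "{x \<in> topspace ?P. truncate_seq x \<in> {y \<in> topspace (full_shift A). \<not> seq_prefix p y}} =
        {x \<in> topspace ?P. \<not> (\<forall>i<length p. x i = Some (p ! i))}"
    unfolding T topspace_quotient_topology by (auto simp: seq_prefix_truncate_seq)
  with * show ?thesis
    unfolding T openin_quotient_topology by auto
qed

section \<open>Compactness and separation of the full shift\<close>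

lemma compact_space_quotient_topology:
  "compact_space X \<Longrightarrow> compact_space (quotient_topology X q)"
  using image_compactin[of X "topspace X" "quotient_topology X q" q]
    quotient_imp_continuous_map[OF quotient_map_quotient_topology[of X q]]
  by (simp add: compact_space_def)

lemma compact_space_full_shift: "compact_space (full_shift A)"
proof (cases "finite A")
  case True
  let ?P = "product_topology (\<lambda>_::nat. discrete_topology A) UNIV"
  have "compact_space ?P"
    using True by (simp add: compact_space_product_topology compact_space_discrete_topology)
  then show ?thesis using True
    by (simp add: full_shift_def compact_space_quotient_topology)
next
  case False
  let ?P = "product_topology (\<lambda>_::nat. Alexandroff_compactification (discrete_topology A)) UNIV"
  have "compact_space ?P"
    by (simp add: compact_space_product_topology compact_space_Alexandroff_compactification)
  then show ?thesis using False
    by (simp add: full_shift_def compact_space_quotient_topology)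
qed

lemma topspace_prefix_subbasis:
  "\<Union>(prefix_subbasis A) = topspace (full_shift A)"
proof -
  have "{y \<in> topspace (full_shift A). seq_prefix [] y} \<in> prefix_subbasis A"
    unfolding prefix_subbasis_def by blast
  then show ?thesis unfolding prefix_subbasis_def by auto
qed

lemma Hausdorff_prefix_topology: "Hausdorff_space (topology_generated_by (prefix_subbasis A))"
  unfolding Hausdorff_space_def topology_generated_by_topspace topspace_prefix_subbasis
proof (intro allI impI)
  fix x y assume xy: "x \<in> topspace (full_shift A) \<and> y \<in> topspace (full_shift A) \<and> x \<noteq> y"
  then obtain p where p: "seq_prefix p x \<noteq> seq_prefix p y" using shift_seq_eqI by blast
  let ?U = "{y \<in> topspace (full_shift A). seq_prefix p y}"
  let ?V = "{y \<in> topspace (full_shift A). \<not> seq_prefix p y}"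
  have op: "openin (topology_generated_by (prefix_subbasis A)) ?U"
    "openin (topology_generated_by (prefix_subbasis A)) ?V"
    by (rule topology_generated_by_Basis, simp add: prefix_subbasis_def)+
  have "disjnt ?U ?V" "disjnt ?V ?U" by (auto simp: disjnt_def)
  with p xy op show "\<exists>U V. openin (topology_generated_by (prefix_subbasis A)) U \<and>
      openin (topology_generated_by (prefix_subbasis A)) V \<and> x \<in> U \<and> y \<in> V \<and> disjnt U V"
    by (smt (verit, del_insts) mem_Collect_eq)
qed

text \<open>A continuous bijection from a compact space onto a Hausdorff space is a homeomorphism,
  which spares us an analysis of the open sets of the quotient topology.\<close>

lemma full_shift_eq_generated: "full_shift A = topology_generated_by (prefix_subbasis A)"
proof -
  have "continuous_map (full_shift A) (topology_generated_by (prefix_subbasis A)) id"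
  proof (rule continuous_on_generated_topo)
    fix U assume "U \<in> prefix_subbasis A"
    then have "openin (full_shift A) U"
      using prefix_clopen by (auto simp: prefix_subbasis_def)
    then show "openin (full_shift A) (id -` U \<inter> topspace (full_shift A))"
      using openin_Int by fastforce
  qed (auto simp: topspace_prefix_subbasis)
  then have "homeomorphic_map (full_shift A) (topology_generated_by (prefix_subbasis A)) id"
    by (intro continuous_imp_homeomorphic_map compact_space_full_shift Hausdorff_prefix_topology)
      (auto simp: topspace_prefix_subbasis)
  then show ?thesis by (simp add: homeomorphic_map_id)
qed

lemma Hausdorff_full_shift: "Hausdorff_space (full_shift A)"
  by (metis full_shift_eq_generated Hausdorff_prefix_topology)

text \<open>Reduces a claim about all open sets to prefix sets. It serves twice: for the
  neighbourhoods of a finite word, and for transferring open sets of sequences to the arrow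
  topology.\<close>

lemma full_shift_open_induct [consumes 1, case_names empty Int Union prefix not_prefix]:
  assumes "openin (full_shift A) U"
    and "P {}"
    and "\<And>U V. P U \<Longrightarrow> P V \<Longrightarrow> P (U \<inter> V)"
    and "\<And>K. (\<And>k. k \<in> K \<Longrightarrow> P k) \<Longrightarrow> P (\<Union>K)"
    and "\<And>p. P {y \<in> topspace (full_shift A). seq_prefix p y}"
    and "\<And>p. P {y \<in> topspace (full_shift A). \<not> seq_prefix p y}"
  shows "P U"
proof -
  have "generate_topology_on (prefix_subbasis A) U"
    using assms(1) by (metis full_shift_eq_generated openin_topology_generated_by_iff)
  then show ?thesis
  proof induction
    case (Basis s)
    then show ?case using assms(5,6) by (auto simp: prefix_subbasis_def)
  qed (use assms(2-4) in auto)
qed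

lemma continuous_map_into_full_shift:
  assumes "\<And>x. x \<in> topspace X \<Longrightarrow> f x \<in> topspace (full_shift A)"
    and "\<And>p. openin X {x \<in> topspace X. seq_prefix p (f x)}"
    and "\<And>p. openin X {x \<in> topspace X. \<not> seq_prefix p (f x)}"
  shows "continuous_map X (full_shift A) f"
proof -
  have "continuous_map X (topology_generated_by (prefix_subbasis A)) f"
  proof (rule continuous_on_generated_topo)
    fix U assume "U \<in> prefix_subbasis A"
    then obtain p where "U = {y \<in> topspace (full_shift A). seq_prefix p y} \<or>
        U = {y \<in> topspace (full_shift A). \<not> seq_prefix p y}"
      by (auto simp: prefix_subbasis_def)
    then have "f -` U \<inter> topspace X = {x \<in> topspace X. seq_prefix p (f x)} \<or>
        f -` U \<inter> topspace X = {x \<in> topspace X. \<not> seq_prefix p (f x)}"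
      using assms(1) by auto
    then show "openin X (f -` U \<inter> topspace X)" using assms(2,3) by metis
  qed (use assms(1) in \<open>auto simp: topspace_prefix_subbasis\<close>)
  then show ?thesis by (metis full_shift_eq_generated)
qed

section \<open>Prepending, and neighbourhoods of finite words\<close>

lemma continuous_map_seq_prepend_Cons:
  assumes "e \<in> A"
  shows "continuous_map (full_shift A) (full_shift A) (seq_prepend [e])"
proof (rule continuous_map_into_full_shift)
  fix p
  have "openin (full_shift A) {y \<in> topspace (full_shift A). seq_prefix p (seq_prepend [e] y)} \<and>
        openin (full_shift A) {y \<in> topspace (full_shift A). \<not> seq_prefix p (seq_prepend [e] y)}"
  proof (cases p)
    case (Cons a q)
    then show ?thesis using prefix_clopen[of A q] by (cases "a = e") auto
  qed auto
  then show "openin (full_shift A) {y \<in> topspace (full_shift A). seq_prefix p (seq_prepend [e] y)}"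
    "openin (full_shift A) {y \<in> topspace (full_shift A). \<not> seq_prefix p (seq_prepend [e] y)}"
    by auto
qed (use assms in auto)

lemma continuous_map_seq_prepend:
  assumes "set p \<subseteq> A"
  shows "continuous_map (full_shift A) (full_shift A) (seq_prepend p)"
  using assms
proof (induction p)
  case (Cons e p)
  have "seq_prepend (e # p) = seq_prepend [e] \<circ> seq_prepend p"
    by (simp add: fun_eq_iff seq_prepend_append)
  then show ?case
    using Cons continuous_map_seq_prepend_Cons[of e A] by (simp add: continuous_map_compose del: o_apply)
next
  case Nil
  have "seq_prepend [] = (\<lambda>z. z)" by auto
  then show ?case by simp
qed

text \<open>Induction over open sets: an intersection unites the exception sets, a prefix set
  containing \<open>p\<close> contains all extensions of \<open>p\<close>, and a negated prefix set
  costs at most one exceptional letter.\<close>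

lemma full_shift_neighbourhood_FinSeq:
  assumes "openin (full_shift A) U" "FinSeq p \<in> U"
  obtains S where "finite S"
    "\<And>y. y \<in> topspace (full_shift A) \<Longrightarrow> seq_prefix p y \<Longrightarrow>
         (\<forall>a\<in>S. \<not> seq_prefix (p @ [a]) y) \<Longrightarrow> y \<in> U"
proof -
  have "FinSeq p \<in> U \<longrightarrow> (\<exists>S. finite S \<and> (\<forall>y \<in> topspace (full_shift A). seq_prefix p y \<longrightarrow>
         (\<forall>a\<in>S. \<not> seq_prefix (p @ [a]) y) \<longrightarrow> y \<in> U))"
    using assms(1)
  proof (induction rule: full_shift_open_induct)
    case (Int U V)
    show ?case
    proof
      assume "FinSeq p \<in> U \<inter> V"
      with Int obtain S T where
        "finite S" "\<forall>y \<in> topspace (full_shift A). seq_prefix p y \<longrightarrow>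
           (\<forall>a\<in>S. \<not> seq_prefix (p @ [a]) y) \<longrightarrow> y \<in> U"
        "finite T" "\<forall>y \<in> topspace (full_shift A). seq_prefix p y \<longrightarrow>
           (\<forall>a\<in>T. \<not> seq_prefix (p @ [a]) y) \<longrightarrow> y \<in> V" by blast
      then show "\<exists>S. finite S \<and> (\<forall>y \<in> topspace (full_shift A). seq_prefix p y \<longrightarrow>
         (\<forall>a\<in>S. \<not> seq_prefix (p @ [a]) y) \<longrightarrow> y \<in> U \<inter> V)"
        by (intro exI[of _ "S \<union> T"]) blast
    qed
  next
    case (Union K)
    then show ?case by (meson Union_iff)
  next
    case (prefix q)
    show ?case
    proof
      assume "FinSeq p \<in> {y \<in> topspace (full_shift A). seq_prefix q y}"
      then obtain r where "p = q @ r" by (auto simp: seq_prefix_FinSeq)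
      then show "\<exists>S. finite S \<and> (\<forall>y \<in> topspace (full_shift A). seq_prefix p y \<longrightarrow>
         (\<forall>a\<in>S. \<not> seq_prefix (p @ [a]) y) \<longrightarrow> y \<in> {y \<in> topspace (full_shift A). seq_prefix q y})"
        by (intro exI[of _ "{}"]) (auto dest: seq_prefix_appendD)
    qed
  next
    case (not_prefix q)
    show ?case
    proof
      assume "FinSeq p \<in> {y \<in> topspace (full_shift A). \<not> seq_prefix q y}"
      then have nq: "\<not> seq_prefix q (FinSeq p)" by simp
      then obtain q' a r where q: "q = q' @ a # r" "seq_prefix q' (FinSeq p)"
        "\<not> seq_prefix (q' @ [a]) (FinSeq p)" by (rule not_seq_prefix_decompose)
      then obtain r' where r': "p = q' @ r'" by (auto simp: seq_prefix_FinSeq)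
      \<comment> \<open>The letter \<open>a\<close> is where \<open>q\<close> leaves
        \<open>p\<close>. If \<open>r'\<close> is empty, \<open>q\<close> runs beyond
        \<open>p\<close> through \<open>a\<close>, which must be avoided; otherwise \<open>p\<close>
        already disagrees with \<open>q\<close> there, and excluding \<open>a\<close> does no
        harm.\<close>
      have imp: "y \<in> {y \<in> topspace (full_shift A). \<not> seq_prefix q y}"
        if y: "y \<in> topspace (full_shift A)" "seq_prefix p y" "\<not> seq_prefix (p @ [a]) y" for y
      proof -
        have "\<not> seq_prefix q y"
        proof
          assume "seq_prefix q y"
          then have 1: "seq_prefix (q' @ [a]) y"
            using q(1) seq_prefix_appendD[of "q' @ [a]" r y] by simp
          obtain z where z: "y = seq_prepend q' z" using y(2) r' seq_prefix_appendD
            by (metis seq_prefix_def)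
          from 1 z have "seq_prefix [a] z" by simp
          moreover have "seq_prefix r' z" "\<not> seq_prefix (r' @ [a]) z" using y z r' by auto
          ultimately show False using q(3) r'
            by (cases r'; cases z rule: shift_seq_cases) (auto simp: seq_prefix_FinSeq)
        qed
        then show ?thesis using y(1) by simp
      qed
      show "\<exists>S. finite S \<and> (\<forall>y \<in> topspace (full_shift A). seq_prefix p y \<longrightarrow>
         (\<forall>a\<in>S. \<not> seq_prefix (p @ [a]) y) \<longrightarrow> y \<in> {y \<in> topspace (full_shift A). \<not> seq_prefix q y})"
        by (rule exI[of _ "{a}"]) (use imp in auto)
    qed
  qed auto
  with assms(2) that show thesis by blast
qed

section \<open>Boundary paths and the edge shift\<close>

lemma boundary_paths_InfSeq:
  "(u, InfSeq f) \<in> boundary_paths E \<longleftrightarrow> u = tail E (f 0) \<and> f \<in> infinite_paths E"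
  by (auto simp: boundary_paths_def)

lemma boundary_paths_FinSeq:
  "(u, FinSeq p) \<in> boundary_paths E \<longleftrightarrow>
     (\<exists>w. pre_digraph.awalk E u p w \<and> infinite_emitter E w)"
  by (auto simp: boundary_paths_def)

context wf_digraph
begin

lemma boundary_paths_Nil [simp]: "(u, FinSeq []) \<in> boundary_paths G \<longleftrightarrow> infinite_emitter G u"
  by (auto simp: boundary_paths_FinSeq awalk_Nil_iff infinite_emitter_def)

text \<open>One recursion for finite and infinite paths. For empty \<open>z\<close> the component
  \<open>head G e\<close> is what carries the condition of being an infinite emitter.\<close>

lemma boundary_paths_Cons:
  "(u, seq_prepend [e] z) \<in> boundary_paths G \<longleftrightarrow>
     e \<in> arcs G \<and> u = tail G e \<and> (head G e, z) \<in> boundary_paths G"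
proof (cases z)
  case (FinSeq p)
  then show ?thesis by (auto simp: boundary_paths_FinSeq awalk_Cons_iff)
next
  case (InfSeq f)
  define g where "g = (\<lambda>n. if n < length [e] then [e] ! n else f (n - length [e]))"
  have g: "g 0 = e" "g (Suc n) = f n" for n by (simp_all add: g_def)
  have z: "seq_prepend [e] z = InfSeq g" by (simp add: InfSeq g_def)
  have "(\<forall>n. P (g n) (g (Suc n))) \<longleftrightarrow> P e (f 0) \<and> (\<forall>n. P (f n) (f (Suc n)))" for P
    by (metis g not0_implies_Suc)
  note this[of "\<lambda>a b. a \<in> arcs G \<and> head G a = tail G b"]
  then show ?thesis unfolding z unfolding InfSeq boundary_paths_InfSeq infinite_paths_def mem_Collect_eq g(1)
    by blast
qed

lemma boundary_path_start: "(u, z) \<in> boundary_paths G \<Longrightarrow> u \<in> verts G"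
  by (cases z rule: shift_seq_cases) (auto simp: boundary_paths_Cons infinite_emitter_def)

lemma boundary_paths_prepend:
  "(u, seq_prepend p z) \<in> boundary_paths G \<longleftrightarrow>
     (\<exists>w. awalk u p w \<and> (w, z) \<in> boundary_paths G)"
proof (induction p arbitrary: u)
  case Nil
  then show ?case by (auto simp: awalk_Nil_iff dest: boundary_path_start)
next
  case (Cons e p)
  show ?case
    by (subst seq_prepend_Cons) (auto simp: boundary_paths_Cons Cons.IH awalk_Cons_iff)
qed

section \<open>Boundary paths as points of the closure of infinite paths\<close>

lemma boundary_path_in_full_shift:
  assumes "(u, z) \<in> boundary_paths G"
  shows "z \<in> topspace (full_shift (arcs G))"
proof (cases z)
  case (FinSeq p)
  then obtain w where w: "awalk u p w" "infinite_emitter G w"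
    using assms by (auto simp: boundary_paths_FinSeq)
  then have "infinite (arcs G)"
    unfolding infinite_emitter_def out_arcs_def by (auto elim: contrapos_nn intro: finite_subset)
  then show ?thesis using w FinSeq by auto
next
  case (InfSeq f)
  then show ?thesis using assms by (auto simp: boundary_paths_InfSeq infinite_paths_def)
qed

text \<open>One outgoing edge is chosen at each vertex, and the choice is followed forever.\<close>

lemma exists_infinite_path:
  assumes "no_sinks G" "v \<in> verts G"
  obtains f where "(v, InfSeq f) \<in> boundary_paths G"
proof -
  have "\<forall>v\<in>verts G. \<exists>e. e \<in> arcs G \<and> tail G e = v"
    using assms(1) unfolding no_sinks_def by fastforce
  then obtain g where g: "\<And>v. v \<in> verts G \<Longrightarrow> g v \<in> arcs G \<and> tail G (g v) = v"
    by metis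
  define x where "x n = ((\<lambda>u. head G (g u)) ^^ n) v" for n
  have x: "x n \<in> verts G" for n
    by (induction n) (use assms(2) g in \<open>auto simp: x_def\<close>)
  have "head G (g (x n)) = x (Suc n)" for n by (simp add: x_def)
  then have "(v, InfSeq (\<lambda>n. g (x n))) \<in> boundary_paths G"
    using g x assms(2) by (auto simp: boundary_paths_InfSeq infinite_paths_def) (simp add: x_def)
  then show thesis by (rule that)
qed

text \<open>A finite boundary path is a limit of infinite paths: its end emits infinitely many
  edges, so one of them escapes the finite exception set of any given neighbourhood, and without
  sinks the path continues from there forever.\<close>

lemma boundary_path_in_edge_shift:
  assumes "no_sinks G" "(u, z) \<in> boundary_paths G"
  shows "z \<in> edge_shift G"
  unfolding edge_shift_def in_closure_of
proof (intro conjI allI impI)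
  show "z \<in> topspace (full_shift (arcs G))" using assms(2) by (rule boundary_path_in_full_shift)
  fix T assume T: "z \<in> T \<and> openin (full_shift (arcs G)) T"
  show "\<exists>y. y \<in> InfSeq ` infinite_paths G \<and> y \<in> T"
  proof (cases z)
    case (FinSeq p)
    then obtain w where w: "awalk u p w" "infinite_emitter G w"
      using assms by (auto simp: boundary_paths_FinSeq)
    obtain S where S: "finite S"
      "\<And>y. y \<in> topspace (full_shift (arcs G)) \<Longrightarrow> seq_prefix p y \<Longrightarrow>
         (\<forall>a\<in>S. \<not> seq_prefix (p @ [a]) y) \<Longrightarrow> y \<in> T"
      using full_shift_neighbourhood_FinSeq[of "arcs G" T p] T FinSeq by metis
    obtain a where a: "a \<in> out_arcs G w" "a \<notin> S"
      using w(2) S(1) unfolding infinite_emitter_def by (meson finite_subset subsetI)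
    then have "head G a \<in> verts G" by auto
    then obtain f where "(head G a, InfSeq f) \<in> boundary_paths G"
      using exists_infinite_path assms(1) by blast
    then have f: "(w, seq_prepend [a] (InfSeq f)) \<in> boundary_paths G"
      using a by (subst boundary_paths_Cons) auto
    let ?y = "seq_prepend p (seq_prepend [a] (InfSeq f))"
    have y: "(u, ?y) \<in> boundary_paths G" using f w by (auto simp only: boundary_paths_prepend)
    have "seq_prefix [b] (seq_prepend [a] (InfSeq f)) \<longleftrightarrow> b = a" for b
      by (simp only: seq_prefix_Cons_Cons) simp
    then have "?y \<in> T"
      using boundary_path_in_full_shift[OF y] a(2)
      by (intro S(2)) (auto simp only: seq_prefix_prepend seq_prefix_append_prepend)
    moreover obtain h where "?y = InfSeq h" by simp
    ultimately show ?thesis using y by (auto simp: boundary_paths_InfSeq)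
  next
    case (InfSeq f)
    then show ?thesis using T assms by (auto simp: boundary_paths_InfSeq)
  qed
qed

text \<open>Every prefix of a point of the closure is a prefix of an infinite path, so consecutive
  edges fit. If a finite sequence ended at a vertex with finitely many outgoing edges, forbidding
  all of them would give a neighbourhood without infinite paths. The empty sequence has to be left
  out: it determines no vertex, and it can lie in the edge shift although there is no infinite
  emitter.\<close>

lemma edge_shift_Cons_boundary_path:
  assumes "seq_prepend [e] z \<in> edge_shift G"
  shows "(tail G e, seq_prepend [e] z) \<in> boundary_paths G"
proof -
  define y where "y = seq_prepend [e] z"
  have y: "y \<in> edge_shift G" using assms by (simp add: y_def)
  have top: "y \<in> topspace (full_shift (arcs G))"
    using y unfolding edge_shift_def in_closure_of by blast
  have approx: "\<exists>f\<in>infinite_paths G. InfSeq f \<in> T"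
    if "openin (full_shift (arcs G)) T" "y \<in> T" for T
    using y that unfolding edge_shift_def in_closure_of by blast
  have prefix: "\<exists>f\<in>infinite_paths G. seq_prefix p (InfSeq f)" if "seq_prefix p y" for p
    using approx[of "{y \<in> topspace (full_shift (arcs G)). seq_prefix p y}"] prefix_clopen that top
    by auto
  have "(tail G e, y) \<in> boundary_paths G"
  proof (cases y)
    case (InfSeq g)
    have "g n \<in> arcs G \<and> head G (g n) = tail G (g (Suc n))" for n
    proof -
      \<comment> \<open>A prefix of length \<open>n + 2\<close> shows the edges \<open>n\<close> and
        \<open>Suc n\<close> together.\<close>
      obtain f where f: "f \<in> infinite_paths G" "seq_prefix (map g [0..<n + 2]) (InfSeq f)"
        using prefix[of "map g [0..<n + 2]"] InfSeq seq_prefix_map_upt by metis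
      have "f i = g i" if "i < n + 2" for i
      proof -
        have "f i = map g [0..<n + 2] ! i" using f(2) that unfolding seq_prefix_InfSeq by simp
        also have "\<dots> = g i" using that by (subst nth_map) (auto simp del: upt_Suc)
        finally show ?thesis .
      qed
      then have "f n = g n" "f (Suc n) = g (Suc n)" by auto
      then show ?thesis using f(1) unfolding infinite_paths_def mem_Collect_eq by (drule_tac spec[of _ n]) simp
    qed
    moreover have "g 0 = e" using InfSeq unfolding y_def by (metis option.inject seq_first.simps(2) seq_first_Cons)
    ultimately show ?thesis using InfSeq by (auto simp: boundary_paths_InfSeq infinite_paths_def)
  next
    case (FinSeq p)
    then have "p \<noteq> []" unfolding y_def by (metis seq_prepend_Cons_neq_Nil(1))
    have "seq_first (FinSeq p) = Some e" using FinSeq unfolding y_def by (metis seq_first_Cons)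
    then obtain xs where p: "p = e # xs" by (auto split: list.splits)
    have split: "\<exists>z'. InfSeq f = seq_prepend p z' \<and> (\<exists>w. awalk (tail G e) p w \<and> (w, z') \<in> boundary_paths G)"
      if f: "f \<in> infinite_paths G" "seq_prefix p (InfSeq f)" for f
    proof -
      obtain z' where z': "InfSeq f = seq_prepend p z'" using f(2) by (auto simp: seq_prefix_def)
      have "f 0 = e" using f(2) p by (auto simp: seq_prefix_InfSeq)
      then have "(tail G e, seq_prepend p z') \<in> boundary_paths G"
        using f(1) z' by (metis boundary_paths_InfSeq)
      then show ?thesis using z' by (auto simp: boundary_paths_prepend)
    qed
    have pp: "seq_prefix p y" using FinSeq by (auto simp: seq_prefix_FinSeq)
    then obtain w where w: "awalk (tail G e) p w" using prefix split by blast
    have "infinite (out_arcs G w)"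
    proof
      assume fin: "finite (out_arcs G w)"
      let ?T = "\<lambda>a. {y \<in> topspace (full_shift (arcs G)). \<not> seq_prefix (p @ [a]) y}"
      let ?U = "{y \<in> topspace (full_shift (arcs G)). seq_prefix p y}"
      have "openin (full_shift (arcs G)) (?U \<inter> (\<Inter>a\<in>out_arcs G w. ?T a))"
      proof (cases "out_arcs G w = {}")
        case False
        then show ?thesis using fin prefix_clopen
          by (intro openin_Int openin_Inter) auto
      qed (use prefix_clopen in auto)
      moreover have "y \<in> ?U \<inter> (\<Inter>a\<in>out_arcs G w. ?T a)"
        using top pp FinSeq by (auto simp: seq_prefix_FinSeq)
      ultimately obtain f where "f \<in> infinite_paths G" "InfSeq f \<in> ?U \<inter> (\<Inter>a\<in>out_arcs G w. ?T a)"
        using approx by meson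
      then have f: "f \<in> infinite_paths G" "seq_prefix p (InfSeq f)"
        "\<forall>a\<in>out_arcs G w. \<not> seq_prefix (p @ [a]) (InfSeq f)" by simp_all
      then obtain z' w' where z': "InfSeq f = seq_prepend p z'" "awalk (tail G e) p w'"
        "(w', z') \<in> boundary_paths G" using split by blast
      \<comment> \<open>The edges of a nonempty path determine its end, so \<open>f\<close> leaves
        \<open>p\<close> through an edge emitted by \<open>w\<close>.\<close>
      have "w' = w" using awalk_ends[OF w z'(2)] \<open>p \<noteq> []\<close> by auto
      show False
      proof (cases z' rule: shift_seq_cases)
        case Nil
        then show ?thesis using z'(1) by simp
      next
        case (Cons a z'')
        then have "a \<in> out_arcs G w" using z'(3) \<open>w' = w\<close> by (auto simp: boundary_paths_Cons)
        moreover have "seq_prefix (p @ [a]) (InfSeq f)" unfolding z'(1) Cons by simp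
        ultimately show ?thesis using f(3) by blast
      qed
    qed
    moreover have "w \<in> verts G" using w by auto
    ultimately show ?thesis using w FinSeq by (auto simp: boundary_paths_FinSeq infinite_emitter_def)
  qed
  then show ?thesis by (simp add: y_def)
qed

lemma seq_shift_in_edge_shift:
  assumes "no_sinks G" "x \<in> edge_shift G"
  shows "seq_shift x \<in> edge_shift G"
proof (cases x rule: shift_seq_cases)
  case Nil
  then show ?thesis using assms(2) by simp
next
  case (Cons e z)
  then show ?thesis
    using assms edge_shift_Cons_boundary_path boundary_path_in_edge_shift boundary_paths_Cons
    by (metis seq_shift_Cons)
qed

end


section \<open>The boundary path space\<close>

text \<open>The discrete factor separates the infinite emitters, which all have the empty edge
  sequence. On nonempty paths the first edge already fixes the start.\<close>

definition boundary_topology :: "('v, 'e) pre_digraph \<Rightarrow> ('v, 'e) path topology" where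
  "boundary_topology E = subtopology
     (prod_topology (discrete_topology (verts E)) (full_shift (arcs E))) (boundary_paths E)"

lemma continuous_map_snd_boundary:
  "continuous_map (boundary_topology E) (full_shift (arcs E)) snd"
  unfolding boundary_topology_def
  by (intro continuous_map_from_subtopology continuous_map_snd)

lemma continuous_map_fst_boundary:
  "continuous_map (boundary_topology E) (discrete_topology (verts E)) fst"
  unfolding boundary_topology_def
  by (intro continuous_map_from_subtopology continuous_map_fst)

lemma openin_boundary_topology_at:
  assumes "openin (boundary_topology E) W" "(v, y) \<in> W"
  obtains V where "openin (full_shift (arcs E)) V" "y \<in> V"
    "\<And>z. z \<in> V \<Longrightarrow> (v, z) \<in> boundary_paths E \<Longrightarrow> (v, z) \<in> W"
proof -
  obtain W' where W': "openin (prod_topology (discrete_topology (verts E)) (full_shift (arcs E))) W'"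
    "W = W' \<inter> boundary_paths E"
    using assms(1) by (auto simp: boundary_topology_def openin_subtopology)
  have "(v, y) \<in> W'" using assms(2) W'(2) by simp
  with W'(1)[unfolded openin_prod_topology_alt, rule_format]
  obtain U V where "openin (full_shift (arcs E)) V" "v \<in> U" "y \<in> V" "U \<times> V \<subseteq> W'"
    by metis
  then show thesis using that[of V] W'(2) by auto
qed

context wf_digraph
begin

lemma topspace_boundary_topology [simp]:
  "topspace (boundary_topology G) = boundary_paths G"
  by (auto simp: boundary_topology_def boundary_path_start boundary_path_in_full_shift)

lemma openin_boundary_start: "openin (boundary_topology G) {x \<in> boundary_paths G. fst x = w}"
proof (cases "w \<in> verts G")
  case True
  then show ?thesis
    using openin_continuous_map_preimage[OF continuous_map_fst_boundary, of G "{w}"] by simp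
next
  case False
  then have "{x \<in> boundary_paths G. fst x = w} = {}" using boundary_path_start by force
  then show ?thesis by (simp only: openin_empty)
qed

text \<open>Prepending \<open>p\<close> gives a path only for those paths that start at
  \<open>w\<close>. They form an open set, so openness of the preimage in this subspace passes to
  the whole space.\<close>

lemma openin_boundary_prepend:
  assumes "awalk u p w" "openin (boundary_topology G) W"
  shows "openin (boundary_topology G)
           {x \<in> boundary_paths G. fst x = w \<and> (u, seq_prepend p (snd x)) \<in> W}"
proof -
  let ?D = "{x \<in> boundary_paths G. fst x = w}"
  have "set p \<subseteq> arcs G" "u \<in> verts G" using assms(1) by auto
  then have "continuous_map (subtopology (boundary_topology G) ?D) (boundary_topology G)
      (\<lambda>x. (u, seq_prepend p (snd x)))"
    unfolding boundary_topology_def[of G]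
    by (intro continuous_map_into_subtopology continuous_map_pairedI)
      (use continuous_map_seq_prepend[of p "arcs G"] continuous_map_snd_boundary[of G] assms(1)
       in \<open>auto simp: boundary_paths_prepend boundary_topology_def[symmetric]
            intro!: continuous_map_from_subtopology
            intro: continuous_map_compose[of _ "full_shift (arcs G)" _ _ "seq_prepend p", unfolded o_def]\<close>)
  then have "openin (subtopology (boundary_topology G) ?D)
      {x \<in> topspace (subtopology (boundary_topology G) ?D). (u, seq_prepend p (snd x)) \<in> W}"
    using assms(2) by (rule openin_continuous_map_preimage)
  then have "openin (boundary_topology G)
      {x \<in> topspace (subtopology (boundary_topology G) ?D). (u, seq_prepend p (snd x)) \<in> W}"
    using openin_boundary_start by (rule openin_trans_full)
  moreover have "{x \<in> topspace (subtopology (boundary_topology G) ?D). (u, seq_prepend p (snd x)) \<in> W} =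
     {x \<in> boundary_paths G. fst x = w \<and> (u, seq_prepend p (snd x)) \<in> W}" by auto
  ultimately show ?thesis by simp
qed

text \<open>A neighbourhood of \<open>v\<close> forbids only finitely many first edges, and an
  infinite emitter has others. A property that is open at \<open>v\<close> can thus be tested on a
  path whose image has a first edge, and therefore a visible start.\<close>

lemma vertex_not_isolated:
  assumes "no_sinks G" "openin (boundary_topology G) W" "(v, FinSeq []) \<in> W"
  obtains a z where "(v, seq_prepend [a] z) \<in> W"
proof -
  have v: "infinite_emitter G v"
    using openin_subset[OF assms(2)] assms(3) by (metis boundary_paths_Nil subsetD topspace_boundary_topology)
  obtain V where V: "openin (full_shift (arcs G)) V" "FinSeq [] \<in> V"
    "\<And>z. z \<in> V \<Longrightarrow> (v, z) \<in> boundary_paths G \<Longrightarrow> (v, z) \<in> W"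
    using openin_boundary_topology_at[OF assms(2,3)] by blast
  obtain S where S: "finite S"
    "\<And>y. y \<in> topspace (full_shift (arcs G)) \<Longrightarrow> seq_prefix [] y \<Longrightarrow>
       (\<forall>a\<in>S. \<not> seq_prefix ([] @ [a]) y) \<Longrightarrow> y \<in> V"
    using full_shift_neighbourhood_FinSeq[OF V(1,2)] by blast
  obtain a where a: "a \<in> out_arcs G v" "a \<notin> S"
    using v S(1) unfolding infinite_emitter_def by (meson finite_subset subsetI)
  then have "head G a \<in> verts G" by auto
  then obtain f where "(head G a, InfSeq f) \<in> boundary_paths G"
    using exists_infinite_path assms(1) by blast
  then have f: "(v, seq_prepend [a] (InfSeq f)) \<in> boundary_paths G"
    using a by (subst boundary_paths_Cons) auto
  have "seq_prepend [a] (InfSeq f) \<in> V"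
    using boundary_path_in_full_shift[OF f] a(2)
    by (intro S(2)) (auto simp only: append_Nil seq_prefix_Cons_Cons seq_prefix_Nil)
  then show thesis using that V(3) f by blast
qed

text \<open>By induction over open sets it suffices to write the set as a union of cylinders when
  \<open>V\<close> is a prefix set or its complement. For a prefix \<open>r\<close>, both \<alpha>
  and \<beta> are extended by \<open>r\<close>; for the complement, they are extended up to a place
  where \<open>r\<close> is left, and the next letter of \<open>r\<close> is forbidden.\<close>

lemma openin_arrow_topology_prepend:
  assumes p: "awalk u p w" and q: "awalk v q w" and V: "openin (full_shift (arcs G)) V"
  shows "openin (arrow_topology (graph_groupoid G))
    {((u, seq_prepend p z), int (length p) - int (length q), (v, seq_prepend q z)) | z.
       (w, z) \<in> boundary_paths G \<and> z \<in> V}"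
    (is "openin ?T (?B V)")
  using V
proof (induction rule: full_shift_open_induct)
  case (Int U V)
  have "?B (U \<inter> V) = ?B U \<inter> ?B V" by auto
  then show ?case using Int by (simp only: openin_Int)
next
  case (Union K)
  have *: "?B (\<Union>K) = (\<Union>V\<in>K. ?B V)" by blast
  show ?case unfolding * using Union by (intro openin_Union) blast
next
  case (prefix r)
  have cyl: "openin ?T (groupoid_cylinder G u (p @ r) v (q @ r) w' {})" if "awalk w r w'" for w'
  proof -
    have "awalk u (p @ r) w'" "awalk v (q @ r) w'" using p q that awalk_appendI by blast+
    then have "groupoid_cylinder G u (p @ r) v (q @ r) w' {} \<in> groupoid_basis G"
      unfolding groupoid_basis_def by blast
    then show ?thesis unfolding graph_groupoid_def by (auto intro!: topology_generated_by_Basis)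
  qed
  have *: "?B {y \<in> topspace (full_shift (arcs G)). seq_prefix r y} =
      (\<Union>w'\<in>{w'. awalk w r w'}. groupoid_cylinder G u (p @ r) v (q @ r) w' {})"
  proof (intro equalityI subsetI)
    fix g assume "g \<in> ?B {y \<in> topspace (full_shift (arcs G)). seq_prefix r y}"
    then obtain z where z: "g = ((u, seq_prepend p (seq_prepend r z)), int (length p) - int (length q),
      (v, seq_prepend q (seq_prepend r z)))" "(w, seq_prepend r z) \<in> boundary_paths G"
      unfolding seq_prefix_def by blast
    from z(2) obtain w' where "awalk w r w'" "(w', z) \<in> boundary_paths G"
      by (auto simp: boundary_paths_prepend)
    then show "g \<in> (\<Union>w'\<in>{w'. awalk w r w'}. groupoid_cylinder G u (p @ r) v (q @ r) w' {})"
      using z(1) by (auto simp: groupoid_cylinder_def seq_prepend_append)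
  next
    fix g assume "g \<in> (\<Union>w'\<in>{w'. awalk w r w'}. groupoid_cylinder G u (p @ r) v (q @ r) w' {})"
    then obtain w' z where w': "awalk w r w'" "(w', z) \<in> boundary_paths G"
      and g: "g = ((u, seq_prepend p (seq_prepend r z)), int (length p) - int (length q),
      (v, seq_prepend q (seq_prepend r z)))"
      by (auto simp: groupoid_cylinder_def seq_prepend_append)
    have "(w, seq_prepend r z) \<in> boundary_paths G" using w' by (auto simp: boundary_paths_prepend)
    then show "g \<in> ?B {y \<in> topspace (full_shift (arcs G)). seq_prefix r y}"
      using g boundary_path_in_full_shift seq_prefix_prepend by blast
  qed
  show ?case unfolding * using cyl by (intro openin_Union) blast
next
  case (not_prefix r)
  \<comment> \<open>Here \<open>s\<close> is the part of \<open>r\<close> that is followed and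
    \<open>a\<close> the letter then avoided. Intersecting with \<open>arcs G\<close> admits letters
    that are no edges: no boundary path contains them, so nothing has to be forbidden.\<close>
  define I where "I = {(s, a, t, w'). r = s @ a # t \<and> awalk w s w'}"
  define C where "C = (\<lambda>(s, a, t :: 'b list, w').
    groupoid_cylinder G u (p @ s) v (q @ s) w' ({a} \<inter> arcs G))"
  have cyl: "openin ?T (C i)" if "i \<in> I" for i
  proof -
    obtain s a t w' where i: "i = (s, a, t, w')" "awalk w s w'" using \<open>i \<in> I\<close> by (auto simp: I_def)
    have "awalk u (p @ s) w'" "awalk v (q @ s) w'" using p q i(2) awalk_appendI by blast+
    then have "C i \<in> groupoid_basis G"
      unfolding i(1) C_def prod.case groupoid_basis_def by blast
    then show ?thesis unfolding graph_groupoid_def by (auto intro!: topology_generated_by_Basis)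
  qed
  have *: "?B {y \<in> topspace (full_shift (arcs G)). \<not> seq_prefix r y} = (\<Union>i\<in>I. C i)"
  proof (intro equalityI subsetI)
    fix g assume "g \<in> ?B {y \<in> topspace (full_shift (arcs G)). \<not> seq_prefix r y}"
    then obtain y where y: "g = ((u, seq_prepend p y), int (length p) - int (length q),
      (v, seq_prepend q y))" "(w, y) \<in> boundary_paths G" "\<not> seq_prefix r y" by blast
    obtain s a t where s: "r = s @ a # t" "seq_prefix s y" "\<not> seq_prefix (s @ [a]) y"
      using not_seq_prefix_decompose[OF y(3)] .
    from s(2) obtain z where z: "y = seq_prepend s z" by (auto simp: seq_prefix_def)
    with y(2) obtain w' where w': "awalk w s w'" "(w', z) \<in> boundary_paths G"
      by (auto simp: boundary_paths_prepend)
    have "seq_first z \<noteq> Some a"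
      using s(3) unfolding z seq_first_eq_Some by auto
    then have "g \<in> C (s, a, t, w')"
      using w' y(1) z by (auto simp: C_def groupoid_cylinder_def seq_prepend_append)
    moreover have "(s, a, t, w') \<in> I" using s(1) w'(1) by (simp add: I_def)
    ultimately show "g \<in> (\<Union>i\<in>I. C i)" by blast
  next
    fix g assume "g \<in> (\<Union>i\<in>I. C i)"
    then obtain s a t w' z where r: "r = s @ a # t" and w': "awalk w s w'" "(w', z) \<in> boundary_paths G"
      and g: "g = ((u, seq_prepend p (seq_prepend s z)), int (length p) - int (length q),
      (v, seq_prepend q (seq_prepend s z)))" and z: "\<forall>e. seq_first z = Some e \<longrightarrow> e \<notin> {a} \<inter> arcs G"
      by (auto simp: I_def C_def groupoid_cylinder_def seq_prepend_append)
    have "\<not> seq_prefix (a # t) z"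
    proof
      assume "seq_prefix (a # t) z"
      then obtain z' where z': "z = seq_prepend [a] z'"
        unfolding seq_prefix_def by (metis seq_prepend_Cons)
      then have "a \<in> arcs G" using w'(2) by (auto simp: boundary_paths_Cons)
      then show False using z z' by auto
    qed
    then have "\<not> seq_prefix r (seq_prepend s z)" using r by simp
    moreover have "(w, seq_prepend s z) \<in> boundary_paths G" using w' by (auto simp: boundary_paths_prepend)
    ultimately show "g \<in> ?B {y \<in> topspace (full_shift (arcs G)). \<not> seq_prefix r y}"
      using g boundary_path_in_full_shift by blast
  qed
  show ?case unfolding * using cyl by (intro openin_Union) blast
qed simp

end

section \<open>The boundary map of a conjugacy\<close>

lemma edge_shift_subset: "edge_shift H \<subseteq> topspace (full_shift (arcs H))"
  unfolding edge_shift_def by (rule closure_of_subset_topspace)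

lemma topspace_edge_shift_topology: "topspace (edge_shift_topology H) = edge_shift H"
  using edge_shift_subset by (auto simp: edge_shift_topology_def)

lemma continuous_map_inverse_edge_shift:
  assumes "bij_betw \<phi> (edge_shift E) (edge_shift F)"
    and "continuous_map (edge_shift_topology E) (edge_shift_topology F) \<phi>"
  shows "continuous_map (edge_shift_topology F) (edge_shift_topology E) (inv_into (edge_shift E) \<phi>)"
proof -
  have "compactin (full_shift (arcs E)) (edge_shift E)"
    unfolding edge_shift_def by (intro closedin_compact_space compact_space_full_shift) simp
  then have "compact_space (edge_shift_topology E)"
    unfolding edge_shift_topology_def by (rule compact_space_subtopology)
  moreover have "Hausdorff_space (edge_shift_topology F)"
    unfolding edge_shift_topology_def by (intro Hausdorff_space_subtopology Hausdorff_full_shift)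
  ultimately have "homeomorphic_map (edge_shift_topology E) (edge_shift_topology F) \<phi>"
    using assms by (intro continuous_imp_homeomorphic_map) (auto simp: topspace_edge_shift_topology bij_betw_def)
  then obtain g where g: "homeomorphic_maps (edge_shift_topology E) (edge_shift_topology F) \<phi> g"
    unfolding homeomorphic_map_maps by blast
  then have cg: "continuous_map (edge_shift_topology F) (edge_shift_topology E) g"
    and "\<And>x. x \<in> edge_shift E \<Longrightarrow> g (\<phi> x) = x"
    by (auto simp: homeomorphic_maps_def topspace_edge_shift_topology)
  then have "g y = inv_into (edge_shift E) \<phi> y" if "y \<in> edge_shift F" for y
    using that assms(1) by (metis bij_betw_imp_surj_on f_inv_into_f inv_into_into)
  with cg show ?thesis by (auto simp: topspace_edge_shift_topology intro: continuous_map_eq)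
qed

text \<open>The properties of the inverse are assumed too, so that the assumptions are symmetric
  under exchanging the two graphs.\<close>

locale edge_shift_conjugacy = E: wf_digraph E + F: wf_digraph F
  for E :: "('v, 'e) pre_digraph" and F :: "('w, 'f) pre_digraph" +
  fixes \<phi> :: "'e shift_seq \<Rightarrow> 'f shift_seq" and \<psi> :: "'f shift_seq \<Rightarrow> 'e shift_seq"
  assumes no_sinks_E: "no_sinks E" and no_sinks_F: "no_sinks F"
    and no_sources_E: "no_sources E" and no_sources_F: "no_sources F"
    and \<phi>_cont: "continuous_map (edge_shift_topology E) (edge_shift_topology F) \<phi>"
    and \<psi>_cont: "continuous_map (edge_shift_topology F) (edge_shift_topology E) \<psi>"
    and \<psi>_\<phi>: "x \<in> edge_shift E \<Longrightarrow> \<psi> (\<phi> x) = x"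
    and \<phi>_\<psi>: "y \<in> edge_shift F \<Longrightarrow> \<phi> (\<psi> y) = y"
    and \<phi>_shift: "x \<in> edge_shift E \<Longrightarrow> \<phi> (seq_shift x) = seq_shift (\<phi> x)"
    and \<psi>_shift: "y \<in> edge_shift F \<Longrightarrow> \<psi> (seq_shift y) = seq_shift (\<psi> y)"
    and \<phi>_length: "x \<in> edge_shift E \<Longrightarrow> seq_length (\<phi> x) = seq_length x"
    and \<psi>_length: "y \<in> edge_shift F \<Longrightarrow> seq_length (\<psi> y) = seq_length y"
begin

section \<open>The conjugacy on boundary paths\<close>

lemma boundary_in_edge_shift: "(u, z) \<in> boundary_paths E \<Longrightarrow> z \<in> edge_shift E"
  using E.boundary_path_in_edge_shift no_sinks_E by blast

lemma \<phi>_in: "x \<in> edge_shift E \<Longrightarrow> \<phi> x \<in> edge_shift F"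
  using continuous_map_image_subset_topspace[OF \<phi>_cont]
  by (auto simp: topspace_edge_shift_topology)

text \<open>Commuting with the shift gives the tail \<open>\<phi> z\<close>, and preservation of
  length excludes the empty value. The edge \<open>f\<close> depends on all of
  \<open>e z\<close>.\<close>

lemma \<phi>_Cons:
  assumes "(u, seq_prepend [e] z) \<in> boundary_paths E"
  obtains f where "\<phi> (seq_prepend [e] z) = seq_prepend [f] (\<phi> z)"
    "(tail F f, seq_prepend [f] (\<phi> z)) \<in> boundary_paths F"
proof -
  have x: "seq_prepend [e] z \<in> edge_shift E" using assms by (rule boundary_in_edge_shift)
  show thesis
  proof (cases "\<phi> (seq_prepend [e] z)" rule: shift_seq_cases)
    case Nil
    then show thesis using \<phi>_length[OF x] by (simp add: zero_enat_def[symmetric])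
  next
    case (Cons f y)
    moreover have "\<phi> z = y" using \<phi>_shift[OF x] Cons by simp
    ultimately show thesis
      using that F.edge_shift_Cons_boundary_path \<phi>_in[OF x] by metis
  qed
qed

text \<open>The emitter puts the empty sequence into the edge shift, outside which nothing is known
  about \<open>\<phi>\<close>.\<close>

lemma \<phi>_Nil: "infinite_emitter E v \<Longrightarrow> \<phi> (FinSeq []) = FinSeq []"
  using \<phi>_length[of "FinSeq []"] boundary_in_edge_shift[of v "FinSeq []"]
  by (auto simp: zero_enat_def[symmetric])

lemma continuous_map_\<phi>_boundary:
  "continuous_map (boundary_topology E) (full_shift (arcs F)) (\<lambda>x. \<phi> (snd x))"
proof -
  have "continuous_map (boundary_topology E) (edge_shift_topology E) snd"
    unfolding edge_shift_topology_def
    by (rule continuous_map_into_subtopology[OF continuous_map_snd_boundary])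
      (auto intro: boundary_in_edge_shift)
  moreover have "continuous_map (edge_shift_topology E) (full_shift (arcs F)) \<phi>"
    using \<phi>_cont unfolding edge_shift_topology_def[of F] continuous_map_in_subtopology by blast
  ultimately show ?thesis using continuous_map_compose by (fastforce simp: o_def)
qed

lemma openin_\<phi>_prefix:
  "openin (boundary_topology E) {x \<in> boundary_paths E. seq_prefix p (\<phi> (snd x))}"
proof -
  have "openin (boundary_topology E) {x \<in> topspace (boundary_topology E).
      \<phi> (snd x) \<in> {y \<in> topspace (full_shift (arcs F)). seq_prefix p y}}"
    by (rule openin_continuous_map_preimage[OF continuous_map_\<phi>_boundary])
      (use prefix_clopen in blast)
  moreover have "{x \<in> topspace (boundary_topology E).
      \<phi> (snd x) \<in> {y \<in> topspace (full_shift (arcs F)). seq_prefix p y}} =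
      {x \<in> boundary_paths E. seq_prefix p (\<phi> (snd x))}"
    using continuous_map_image_subset_topspace[OF continuous_map_\<phi>_boundary] by auto
  ultimately show ?thesis by simp
qed

text \<open>Paths \<open>x\<^sub>n\<close> from an infinite emitter with distinct first edges tend to the empty sequence, so
  \<open>\<phi> (e x\<^sub>n)\<close> eventually starts with the edge \<open>\<phi> e\<close>. This makes the range of \<open>\<phi> e\<close>
  visible in \<open>\<phi> x\<^sub>n\<close>, which does not depend on the edge \<open>e\<close>.\<close>

definition lifts_range :: "'f \<Rightarrow> 'e \<Rightarrow> ('v, 'e) path set" where
  "lifts_range f e = {x \<in> boundary_paths E. fst x = head E e \<and> seq_prefix [f] (\<phi> (seq_prepend [e] (snd x)))}"

lemma openin_lifts_range:
  assumes "e \<in> arcs E"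
  shows "openin (boundary_topology E) (lifts_range f e)"
proof -
  have "E.awalk (tail E e) [e] (head E e)" using assms by (rule E.arc_implies_awalk)
  from E.openin_boundary_prepend[OF this openin_\<phi>_prefix[of "[f]"]]
  have "openin (boundary_topology E) {x \<in> boundary_paths E. fst x = head E e \<and>
      (tail E e, seq_prepend [e] (snd x)) \<in> {x \<in> boundary_paths E. seq_prefix [f] (\<phi> (snd x))}}" .
  moreover have "{x \<in> boundary_paths E. fst x = head E e \<and>
      (tail E e, seq_prepend [e] (snd x)) \<in> {x \<in> boundary_paths E. seq_prefix [f] (\<phi> (snd x))}} =
      lifts_range f e"
    using assms by (auto simp: lifts_range_def E.boundary_paths_Cons)
  ultimately show ?thesis by simp
qed

text \<open>The image of \<open>e a z\<close> is the path \<open>f\<close> followed by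
  \<open>\<phi> (a z)\<close>, so its first two edges are \<open>f\<close> and
  \<open>b\<close>.\<close>

lemma lifts_range_Cons:
  assumes "e \<in> arcs E" "(head E e, seq_prepend [a] z) \<in> lifts_range f e"
    "\<phi> (seq_prepend [a] z) = seq_prepend [b] z'"
  shows "tail F b = head F f"
proof -
  have bp: "(head E e, seq_prepend [a] z) \<in> boundary_paths E"
    and pre: "seq_prefix [f] (\<phi> (seq_prepend [e] (seq_prepend [a] z)))"
    using assms(2) by (auto simp: lifts_range_def)
  have "(tail E e, seq_prepend [e] (seq_prepend [a] z)) \<in> boundary_paths E"
    using bp assms(1) E.boundary_paths_Cons by blast
  then obtain g where g: "\<phi> (seq_prepend [e] (seq_prepend [a] z)) = seq_prepend [g] (\<phi> (seq_prepend [a] z))"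
    "(tail F g, seq_prepend [g] (\<phi> (seq_prepend [a] z))) \<in> boundary_paths F"
    by (rule \<phi>_Cons)
  have "g = f" using pre unfolding g(1) by simp
  then show ?thesis using g(2) unfolding assms(3) by (metis F.boundary_paths_Cons)
qed

lemma \<phi>_edge:
  assumes "e \<in> arcs E" "infinite_emitter E (head E e)"
  obtains f where "\<phi> (FinSeq [e]) = FinSeq [f]" "f \<in> arcs F" "infinite_emitter F (head F f)"
    "(head E e, FinSeq []) \<in> lifts_range f e"
proof -
  have e: "FinSeq [e] = seq_prepend [e] (FinSeq [])" by simp
  have "(tail E e, seq_prepend [e] (FinSeq [])) \<in> boundary_paths E"
    using assms unfolding E.boundary_paths_Cons by simp
  then obtain f where f: "\<phi> (seq_prepend [e] (FinSeq [])) = seq_prepend [f] (\<phi> (FinSeq []))"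
    "(tail F f, seq_prepend [f] (\<phi> (FinSeq []))) \<in> boundary_paths F"
    by (rule \<phi>_Cons)
  have n: "\<phi> (FinSeq []) = FinSeq []" using assms(2) by (rule \<phi>_Nil)
  have "f \<in> arcs F" "infinite_emitter F (head F f)"
    using f(2) unfolding F.boundary_paths_Cons n by auto
  moreover have "(head E e, FinSeq []) \<in> lifts_range f e"
    using assms unfolding lifts_range_def mem_Collect_eq fst_conv snd_conv f(1) by simp
  ultimately show thesis using that[of f] f(1) n by simp
qed

text \<open>Two neighbourhoods of the same emitter share a nonempty path \<open>a z\<close>, and the
  start of \<open>\<phi> (a z)\<close> equals both heads.\<close>

lemma \<phi>_edge_head_unique:
  assumes "e \<in> arcs E" "e' \<in> arcs E" "head E e = head E e'" "infinite_emitter E (head E e)"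
    and "\<phi> (FinSeq [e]) = FinSeq [f]" "\<phi> (FinSeq [e']) = FinSeq [f']"
  shows "head F f = head F f'"
proof -
  let ?W = "lifts_range f e \<inter> lifts_range f' e'"
  have "openin (boundary_topology E) ?W" using assms(1,2) openin_lifts_range by blast
  moreover have "(head E e, FinSeq []) \<in> lifts_range f e"
    using \<phi>_edge[OF assms(1,4)] assms(5) by (metis list.inject shift_seq.inject(1))
  moreover have "(head E e', FinSeq []) \<in> lifts_range f' e'"
    using \<phi>_edge[of e'] assms by (metis list.inject shift_seq.inject(1))
  ultimately obtain a z where az: "(head E e, seq_prepend [a] z) \<in> ?W"
    using E.vertex_not_isolated[OF no_sinks_E, of ?W "head E e"] assms(3) by auto
  then have "(head E e, seq_prepend [a] z) \<in> boundary_paths E" by (auto simp: lifts_range_def)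
  then obtain b where b: "\<phi> (seq_prepend [a] z) = seq_prepend [b] (\<phi> z)" by (rule \<phi>_Cons)
  have "tail F b = head F f" "tail F b = head F f'"
    using lifts_range_Cons b az assms(1,2,3) by (metis IntD1, metis IntD2)
  then show ?thesis by simp
qed

text \<open>Meaningful at infinite emitters only; \<open>vertex_map_eq\<close> removes the
  dependence on the chosen edge.\<close>

definition vertex_map :: "'v \<Rightarrow> 'w" where
  "vertex_map v = head F (the (seq_first (\<phi> (FinSeq [SOME e. e \<in> in_arcs E v]))))"

text \<open>A nonempty path need not start at an infinite emitter, so \<open>vertex_map\<close> is
  no help there and the start is read off from the first edge of the image.\<close>

definition boundary_map :: "('v, 'e) path \<Rightarrow> ('w, 'f) path" where
  "boundary_map x = (if snd x = FinSeq [] then (vertex_map (fst x), FinSeq [])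
     else (tail F (the (seq_first (\<phi> (snd x)))), \<phi> (snd x)))"

lemma vertex_map_eq:
  assumes "e \<in> arcs E" "infinite_emitter E (head E e)" "\<phi> (FinSeq [e]) = FinSeq [f]"
  shows "vertex_map (head E e) = head F f"
proof -
  define e' where "e' = (SOME e'. e' \<in> in_arcs E (head E e))"
  have "e' \<in> in_arcs E (head E e)"
    unfolding e'_def using assms(1) by (intro someI[of "\<lambda>e'. e' \<in> in_arcs E (head E e)" e]) simp
  then have e': "e' \<in> arcs E" "head E e' = head E e" by auto
  then obtain f' where f': "\<phi> (FinSeq [e']) = FinSeq [f']"
    using \<phi>_edge[OF e'(1)] assms(2) by metis
  then have "vertex_map (head E e) = head F f'"
    by (simp add: vertex_map_def e'_def)
  also have "\<dots> = head F f"
    using \<phi>_edge_head_unique[OF e'(1) assms(1) e'(2) _ f' assms(3)] assms(2) e'(2) by simp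
  finally show ?thesis .
qed

lemma exists_edge_into:
  assumes "infinite_emitter E v"
  obtains e where "e \<in> arcs E" "head E e = v"
proof -
  have "in_arcs E v \<noteq> {}" using assms no_sources_E by (simp add: infinite_emitter_def no_sources_def)
  then obtain e where "e \<in> in_arcs E v" by blast
  then show thesis by (intro that[of e]) auto
qed

section \<open>The boundary map and concatenation\<close>

lemma snd_boundary_map:
  assumes "x \<in> boundary_paths E"
  shows "snd (boundary_map x) = \<phi> (snd x)"
  using assms \<phi>_Nil by (cases x) (auto simp: boundary_map_def)

text \<open>The point is that the new edge ends where the image of the rest starts. For empty
  \<open>z\<close> this is what \<open>vertex_map\<close> was made for; otherwise it is the path
  condition in \<open>F\<close>.\<close>

lemma boundary_map_Cons:
  assumes "(u, seq_prepend [e] z) \<in> boundary_paths E"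
  obtains f where "f \<in> arcs F" "head F f = fst (boundary_map (head E e, z))"
    "boundary_map (u, seq_prepend [e] z) =
       (tail F f, seq_prepend [f] (snd (boundary_map (head E e, z))))"
proof -
  have e: "e \<in> arcs E" "(head E e, z) \<in> boundary_paths E"
    using assms by (auto simp: E.boundary_paths_Cons)
  obtain f where f: "\<phi> (seq_prepend [e] z) = seq_prepend [f] (\<phi> z)"
    "(tail F f, seq_prepend [f] (\<phi> z)) \<in> boundary_paths F"
    using assms by (rule \<phi>_Cons)
  have hf: "f \<in> arcs F" "(head F f, \<phi> z) \<in> boundary_paths F"
    using f(2) by (auto simp: F.boundary_paths_Cons)
  have "head F f = fst (boundary_map (head E e, z))"
  proof (cases z rule: shift_seq_cases)
    case Nil
    then have ie: "infinite_emitter E (head E e)" using e(2) by simp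
    have "\<phi> (FinSeq [e]) = FinSeq [f]" using f(1) \<phi>_Nil[OF ie] Nil by simp
    then show ?thesis using vertex_map_eq[OF e(1) ie] Nil by (simp add: boundary_map_def)
  next
    case (Cons a z')
    obtain b where b: "\<phi> z = seq_prepend [b] (\<phi> z')"
      using \<phi>_Cons e(2) Cons by metis
    have "head F f = tail F b" using hf(2) unfolding b by (simp add: F.boundary_paths_Cons)
    then show ?thesis using b Cons by (simp add: boundary_map_def)
  qed
  moreover have "boundary_map (u, seq_prepend [e] z) = (tail F f, seq_prepend [f] (\<phi> z))"
    by (simp add: boundary_map_def f(1))
  moreover have "snd (boundary_map (head E e, z)) = \<phi> z" using snd_boundary_map[OF e(2)] by simp
  ultimately show thesis using that hf(1) by simp
qed

lemma boundary_map_in: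
  assumes "x \<in> boundary_paths E"
  shows "boundary_map x \<in> boundary_paths F"
proof (cases "snd x" rule: shift_seq_cases)
  case Nil
  then have x: "x = (fst x, FinSeq [])" by (simp add: prod_eq_iff)
  then have v: "infinite_emitter E (fst x)" using assms E.boundary_paths_Nil by metis
  then obtain e where e: "e \<in> arcs E" "head E e = fst x" by (rule exists_edge_into)
  obtain f where f: "\<phi> (FinSeq [e]) = FinSeq [f]" "infinite_emitter F (head F f)"
    using \<phi>_edge[OF e(1)] e(2) v by metis
  have "vertex_map (fst x) = head F f" using vertex_map_eq[OF e(1) _ f(1)] e v by simp
  then show ?thesis using Nil f by (simp add: boundary_map_def)
next
  case (Cons e z)
  then have "(fst x, seq_prepend [e] z) \<in> boundary_paths E" using assms by (metis prod.collapse)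
  then obtain f where f: "\<phi> (seq_prepend [e] z) = seq_prepend [f] (\<phi> z)"
    "(tail F f, seq_prepend [f] (\<phi> z)) \<in> boundary_paths F"
    by (rule \<phi>_Cons)
  then show ?thesis using Cons by (simp add: boundary_map_def)
qed

text \<open>One edge at a time. The new prefix \<open>p'\<close> may vary with \<open>z\<close>;
  only its length and its end are controlled.\<close>

lemma boundary_map_prepend:
  assumes "E.awalk u p w" "(w, z) \<in> boundary_paths E"
  obtains u' p' where "length p' = length p" "F.awalk u' p' (fst (boundary_map (w, z)))"
    "boundary_map (u, seq_prepend p z) = (u', seq_prepend p' (snd (boundary_map (w, z))))"
  using assms(1)
proof (induction p arbitrary: u thesis)
  case Nil
  then have "boundary_map (w, z) \<in> boundary_paths F" using assms(2) boundary_map_in by blast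
  then have "fst (boundary_map (w, z)) \<in> verts F" by (metis F.boundary_path_start prod.collapse)
  then show ?case using Nil by (intro Nil(1)[of "[]"]) (auto simp: F.awalk_Nil_iff E.awalk_Nil_iff)
next
  case (Cons e p)
  then have e: "e \<in> arcs E" "u = tail E e" "E.awalk (head E e) p w" by (auto simp: E.awalk_Cons_iff)
  obtain u' p' where p': "length p' = length p" "F.awalk u' p' (fst (boundary_map (w, z)))"
    "boundary_map (head E e, seq_prepend p z) = (u', seq_prepend p' (snd (boundary_map (w, z))))"
    using Cons.IH e(3) by blast
  have "(head E e, seq_prepend p z) \<in> boundary_paths E"
    using e(3) assms(2) by (auto simp: E.boundary_paths_prepend)
  then have "(u, seq_prepend [e] (seq_prepend p z)) \<in> boundary_paths E"
    using e by (auto simp: E.boundary_paths_Cons)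
  then obtain f where f: "f \<in> arcs F" "head F f = u'"
    "boundary_map (u, seq_prepend [e] (seq_prepend p z)) =
       (tail F f, seq_prepend [f] (seq_prepend p' (snd (boundary_map (w, z)))))"
    by (rule boundary_map_Cons) (simp add: p'(3))
  show ?case
  proof (rule Cons.prems(1))
    show "length (f # p') = length (e # p)" using p' by simp
    show "F.awalk (tail F f) (f # p') (fst (boundary_map (w, z)))"
      using f p' by (auto simp: F.awalk_Cons_iff)
    show "boundary_map (u, seq_prepend (e # p) z) =
        (tail F f, seq_prepend (f # p') (snd (boundary_map (w, z))))"
      using f(3) by (simp add: seq_prepend_append)
  qed
qed

text \<open>The start of the image is locally constant. Near an infinite emitter,
  \<open>lifts_range f e\<close> consists of paths whose images all start at the head of
  \<open>f\<close>; near a nonempty path, fixing the first edge of the image suffices.\<close>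

lemma openin_boundary_map_start:
  "openin (boundary_topology E) {x \<in> boundary_paths E. fst (boundary_map x) = w}"
proof (subst openin_subopen, intro ballI)
  fix x assume "x \<in> {x \<in> boundary_paths E. fst (boundary_map x) = w}"
  then have x: "x \<in> boundary_paths E" "fst (boundary_map x) = w" by auto
  show "\<exists>T. openin (boundary_topology E) T \<and> x \<in> T \<and>
      T \<subseteq> {x \<in> boundary_paths E. fst (boundary_map x) = w}"
  proof (cases "snd x" rule: shift_seq_cases)
    case Nil
    then have xv: "x = (fst x, FinSeq [])" by (simp add: prod_eq_iff)
    then have v: "infinite_emitter E (fst x)" using x(1) E.boundary_paths_Nil by metis
    then obtain e where e: "e \<in> arcs E" "head E e = fst x" by (rule exists_edge_into)
    obtain f where f: "\<phi> (FinSeq [e]) = FinSeq [f]" "(head E e, FinSeq []) \<in> lifts_range f e"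
      using \<phi>_edge[OF e(1)] e(2) v by metis
    have w: "w = head F f"
      using vertex_map_eq[OF e(1) _ f(1)] e v x(2) Nil by (simp add: boundary_map_def)
    have "fst (boundary_map y) = w" if y: "y \<in> lifts_range f e" for y
    proof (cases "snd y" rule: shift_seq_cases)
      case y': Nil
      then have "boundary_map y = boundary_map x"
        using y Nil e by (simp add: boundary_map_def lifts_range_def)
      then show ?thesis using x(2) by simp
    next
      case (Cons a z)
      then have "y = (head E e, seq_prepend [a] z)"
        using y by (simp add: lifts_range_def prod_eq_iff)
      with y have y': "(head E e, seq_prepend [a] z) \<in> lifts_range f e" "y = (head E e, seq_prepend [a] z)"
        by simp_all
      then have "(head E e, seq_prepend [a] z) \<in> boundary_paths E" by (auto simp: lifts_range_def)
      then obtain b where b: "\<phi> (seq_prepend [a] z) = seq_prepend [b] (\<phi> z)" by (rule \<phi>_Cons)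
      then show ?thesis
        using lifts_range_Cons[OF e(1) y'(1) b] y'(2) w by (simp add: boundary_map_def)
    qed
    then have "lifts_range f e \<subseteq> {x \<in> boundary_paths E. fst (boundary_map x) = w}"
      by (auto simp: lifts_range_def)
    moreover have "x \<in> lifts_range f e" using f(2) e(2) xv by simp
    ultimately show ?thesis using openin_lifts_range[OF e(1)] by blast
  next
    case (Cons a z)
    then have "(fst x, seq_prepend [a] z) \<in> boundary_paths E" using x(1) by (metis prod.collapse)
    then obtain b where b: "\<phi> (seq_prepend [a] z) = seq_prepend [b] (\<phi> z)" by (rule \<phi>_Cons)
    let ?T = "{x \<in> boundary_paths E. seq_prefix [b] (\<phi> (snd x))}"
    have *: "fst (boundary_map y) = tail F b" if y: "y \<in> ?T" for y
    proof -
      obtain z' where z': "\<phi> (snd y) = seq_prepend [b] z'" using y by (auto simp: seq_prefix_def)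
      have "snd y \<noteq> FinSeq []"
      proof
        assume "snd y = FinSeq []"
        moreover from this have "infinite_emitter E (fst y)"
          using y by (cases y) auto
        ultimately show False using \<phi>_Nil z' by simp
      qed
      then show ?thesis using z' by (simp add: boundary_map_def)
    qed
    have "x \<in> ?T" using x(1) Cons b by simp
    with * have "?T \<subseteq> {x \<in> boundary_paths E. fst (boundary_map x) = w}"
      using x(2) by auto
    then show ?thesis using openin_\<phi>_prefix[of "[b]"] \<open>x \<in> ?T\<close> by blast
  qed
qed

lemma conjugacy_sym: "edge_shift_conjugacy F E \<psi> \<phi>"
  by unfold_locales
    (use no_sinks_E no_sinks_F no_sources_E no_sources_F \<phi>_cont \<psi>_cont \<psi>_\<phi> \<phi>_\<psi>
      \<phi>_shift \<psi>_shift \<phi>_length \<psi>_length in auto)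

end

context edge_shift_conjugacy
begin

interpretation inverse: edge_shift_conjugacy F E \<psi> \<phi>
  by (rule conjugacy_sym)

text \<open>At an infinite emitter, the edge \<open>f\<close> with \<open>\<phi> e = f\<close>
  enters the image vertex and \<open>\<psi> f = e\<close>, so \<open>f\<close> can be used to
  evaluate the inverse vertex map, and the head of \<open>e\<close> comes back.\<close>

lemma inverse_boundary_map:
  assumes "x \<in> boundary_paths E"
  shows "inverse.boundary_map (boundary_map x) = x"
proof (cases "snd x" rule: shift_seq_cases)
  case Nil
  then have xv: "x = (fst x, FinSeq [])" by (simp add: prod_eq_iff)
  then have v: "infinite_emitter E (fst x)" using assms E.boundary_paths_Nil by metis
  then obtain e where e: "e \<in> arcs E" "head E e = fst x" by (rule exists_edge_into)
  obtain f where f: "\<phi> (FinSeq [e]) = FinSeq [f]" "f \<in> arcs F" "infinite_emitter F (head F f)"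
    using \<phi>_edge[OF e(1)] e(2) v by metis
  have w: "boundary_map x = (head F f, FinSeq [])"
    using vertex_map_eq[OF e(1) _ f(1)] e v Nil by (simp add: boundary_map_def)
  have "(tail E e, seq_prepend [e] (FinSeq [])) \<in> boundary_paths E"
    using e v by (simp only: E.boundary_paths_Cons) simp
  then have "FinSeq [e] \<in> edge_shift E" using boundary_in_edge_shift by fastforce
  then have "\<psi> (FinSeq [f]) = FinSeq [e]" using \<psi>_\<phi> f(1) by metis
  then have "inverse.vertex_map (head F f) = head E e"
    using inverse.vertex_map_eq f(2,3) by blast
  then show ?thesis using w e(2) xv by (simp add: inverse.boundary_map_def)
next
  case (Cons e z)
  then have x: "(fst x, seq_prepend [e] z) \<in> boundary_paths E" using assms by (metis prod.collapse)
  then obtain f where f: "\<phi> (seq_prepend [e] z) = seq_prepend [f] (\<phi> z)" by (rule \<phi>_Cons)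
  then have "boundary_map x = (tail F f, seq_prepend [f] (\<phi> z))"
    using Cons by (simp add: boundary_map_def)
  moreover have "\<psi> (seq_prepend [f] (\<phi> z)) = seq_prepend [e] z"
    using \<psi>_\<phi>[OF boundary_in_edge_shift[OF x]] f by simp
  moreover have "fst x = tail E e" using x by (simp add: E.boundary_paths_Cons)
  ultimately show ?thesis using Cons by (simp add: inverse.boundary_map_def prod_eq_iff)
qed


section \<open>The groupoid map of a conjugacy\<close>

definition groupoid_map :: "('v, 'e) graph_arrow \<Rightarrow> ('w, 'f) graph_arrow" where
  "groupoid_map = (\<lambda>(x, k, y). (boundary_map x, k, boundary_map y))"

lemma graph_arrow_ends:
  assumes "(x, k, y) \<in> graph_groupoid_arrows E"
  shows "x \<in> boundary_paths E" "y \<in> boundary_paths E"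
  using assms by (auto simp: graph_groupoid_arrows_def E.boundary_paths_prepend)

text \<open>Both ends share the tail \<open>z\<close>. Their new prefixes end at the start of the
  image of that tail and keep their lengths, hence also the difference of lengths.\<close>

lemma groupoid_map_in:
  assumes "g \<in> graph_groupoid_arrows E"
  shows "groupoid_map g \<in> graph_groupoid_arrows F"
proof -
  obtain u p v q w z where
    g: "g = ((u, seq_prepend p z), int (length p) - int (length q), (v, seq_prepend q z))"
    and wz: "E.awalk u p w" "E.awalk v q w" "(w, z) \<in> boundary_paths E"
    using assms unfolding graph_groupoid_arrows_def by blast
  obtain u' p' where p: "length p' = length p" "F.awalk u' p' (fst (boundary_map (w, z)))"
    "boundary_map (u, seq_prepend p z) = (u', seq_prepend p' (snd (boundary_map (w, z))))"
    using wz(1,3) by (rule boundary_map_prepend)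
  obtain v' q' where q: "length q' = length q" "F.awalk v' q' (fst (boundary_map (w, z)))"
    "boundary_map (v, seq_prepend q z) = (v', seq_prepend q' (snd (boundary_map (w, z))))"
    using wz(2,3) by (rule boundary_map_prepend)
  have "boundary_map (w, z) \<in> boundary_paths F" using wz(3) by (rule boundary_map_in)
  then have "(fst (boundary_map (w, z)), snd (boundary_map (w, z))) \<in> boundary_paths F" by simp
  moreover have "groupoid_map g = ((u', seq_prepend p' (snd (boundary_map (w, z)))),
      int (length p') - int (length q'), (v', seq_prepend q' (snd (boundary_map (w, z)))))"
    using p q by (simp add: g groupoid_map_def)
  ultimately show ?thesis unfolding graph_groupoid_arrows_def using p(2) q(2) by blast
qed

end

context edge_shift_conjugacy
begin

interpretation inverse: edge_shift_conjugacy F E \<psi> \<phi>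
  by (rule conjugacy_sym)

lemma inverse_groupoid_map:
  assumes "g \<in> graph_groupoid_arrows E"
  shows "inverse.groupoid_map (groupoid_map g) = g"
proof -
  obtain x k y where g: "g = (x, k, y)" by (cases g)
  then show ?thesis using assms graph_arrow_ends[of x k y] inverse_boundary_map
    by (simp add: groupoid_map_def inverse.groupoid_map_def)
qed

lemma boundary_map_inverse:
  assumes "y \<in> boundary_paths F"
  shows "boundary_map (inverse.boundary_map y) = y"
  using inverse.inverse_boundary_map[OF assms] .

text \<open>Pulling an arrow \<open>(\<alpha>\<gamma>, k, \<beta>\<gamma>)\<close> back along the inverse boundary map, which also respects
  prefixes, yields a decomposition with prefixes of the same lengths as \<open>\<alpha>\<close> and \<open>\<beta>\<close>.\<close>

lemma groupoid_map_open_preimage: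
  assumes "C \<in> groupoid_basis F" "g \<in> graph_groupoid_arrows E" "groupoid_map g \<in> C"
  obtains T where "openin (arrow_topology (graph_groupoid E)) T" "g \<in> T"
    "\<And>h. h \<in> T \<Longrightarrow> groupoid_map h \<in> C"
proof -
  obtain u p v q w S where C: "C = groupoid_cylinder F u p v q w S"
    and pq: "F.awalk u p w" "F.awalk v q w" and S: "finite S"
    using assms(1) unfolding groupoid_basis_def by blast
  obtain x k y where g: "g = (x, k, y)" by (cases g)
  have xy: "x \<in> boundary_paths E" "y \<in> boundary_paths E"
    using graph_arrow_ends assms(2) g by blast+
  obtain z where z: "boundary_map x = (u, seq_prepend p z)" "boundary_map y = (v, seq_prepend q z)"
    "k = int (length p) - int (length q)" "(w, z) \<in> boundary_paths F"
    "\<forall>e. seq_first z = Some e \<longrightarrow> e \<notin> S"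
    using assms(3) unfolding C g groupoid_map_def groupoid_cylinder_def by auto
  define w' z' where "w' = fst (inverse.boundary_map (w, z))" "z' = snd (inverse.boundary_map (w, z))"
  have wz': "inverse.boundary_map (w, z) = (w', z')" by (simp add: w'_z'_def)
  have bwz': "boundary_map (w', z') = (w, z)" using boundary_map_inverse[OF z(4)] wz' by simp
  have wz'_in: "(w', z') \<in> boundary_paths E" using inverse.boundary_map_in[OF z(4)] wz' by simp
  obtain u' p' where p': "length p' = length p" "E.awalk u' p' w'" "x = (u', seq_prepend p' z')"
    using inverse.boundary_map_prepend[OF pq(1) z(4)] wz' inverse_boundary_map[OF xy(1)] z(1)
    by (metis fst_conv snd_conv)
  obtain v' q' where q': "length q' = length q" "E.awalk v' q' w'" "y = (v', seq_prepend q' z')"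
    using inverse.boundary_map_prepend[OF pq(2) z(4)] wz' inverse_boundary_map[OF xy(2)] z(2)
    by (metis fst_conv snd_conv)
  define P where "P = {x \<in> boundary_paths E. seq_prefix p (\<phi> (snd x)) \<and> fst (boundary_map x) = u}"
  define Q where "Q = {x \<in> boundary_paths E. seq_prefix q (\<phi> (snd x)) \<and> fst (boundary_map x) = v}"
  have open_pre: "openin (boundary_topology E)
      {x \<in> boundary_paths E. seq_prefix r (\<phi> (snd x)) \<and> fst (boundary_map x) = a}" for r a
  proof -
    have "{x \<in> boundary_paths E. seq_prefix r (\<phi> (snd x)) \<and> fst (boundary_map x) = a} =
      {x \<in> boundary_paths E. seq_prefix r (\<phi> (snd x))} \<inter> {x \<in> boundary_paths E. fst (boundary_map x) = a}"
      by auto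
    then show ?thesis using openin_\<phi>_prefix openin_boundary_map_start by (simp only: openin_Int)
  qed
  \<comment> \<open>Finitely many closed prefix sets are removed, which also covers empty
    \<open>S\<close>.\<close>
  have open_not: "openin (boundary_topology E) {x \<in> boundary_paths E. \<forall>e\<in>S. \<not> seq_prefix [e] (\<phi> (snd x))}"
  proof -
    have "closedin (full_shift (arcs F)) (\<Union>e\<in>S. {y \<in> topspace (full_shift (arcs F)). seq_prefix [e] y})"
    proof (rule closedin_Union)
      fix T assume "T \<in> (\<lambda>e. {y \<in> topspace (full_shift (arcs F)). seq_prefix [e] y}) ` S"
      then obtain e where e: "T = {y \<in> topspace (full_shift (arcs F)). seq_prefix [e] y}" by blast
      have "topspace (full_shift (arcs F)) - T = {y \<in> topspace (full_shift (arcs F)). \<not> seq_prefix [e] y}"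
        unfolding e by blast
      then show "closedin (full_shift (arcs F)) T"
        unfolding closedin_def using prefix_clopen e by auto
    qed (use S in simp)
    then have "openin (boundary_topology E) {x \<in> topspace (boundary_topology E). \<phi> (snd x) \<in>
        topspace (full_shift (arcs F)) - (\<Union>e\<in>S. {y \<in> topspace (full_shift (arcs F)). seq_prefix [e] y})}"
      by (intro openin_continuous_map_preimage[OF continuous_map_\<phi>_boundary]) blast
    moreover have "{x \<in> topspace (boundary_topology E). \<phi> (snd x) \<in>
        topspace (full_shift (arcs F)) - (\<Union>e\<in>S. {y \<in> topspace (full_shift (arcs F)). seq_prefix [e] y})} =
        {x \<in> boundary_paths E. \<forall>e\<in>S. \<not> seq_prefix [e] (\<phi> (snd x))}"
      using continuous_map_image_subset_topspace[OF continuous_map_\<phi>_boundary] by auto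
    ultimately show ?thesis by simp
  qed
  \<comment> \<open>The images of \<open>p' y\<close> and \<open>q' y\<close> need not begin with
    \<open>p\<close> and \<open>q\<close> for every tail \<open>y\<close>. The set \<open>W\<close>
    keeps the tails for which they do, with the right starts, and whose own image starts at
    \<open>w\<close> and avoids \<open>S\<close>.\<close>
  define W where "W = {x \<in> boundary_paths E. fst x = w' \<and> (u', seq_prepend p' (snd x)) \<in> P} \<inter>
    {x \<in> boundary_paths E. fst x = w' \<and> (v', seq_prepend q' (snd x)) \<in> Q} \<inter>
    {x \<in> boundary_paths E. fst (boundary_map x) = w} \<inter>
    {x \<in> boundary_paths E. \<forall>e\<in>S. \<not> seq_prefix [e] (\<phi> (snd x))}"
  have "openin (boundary_topology E) W"
    unfolding W_def P_def Q_def
    by (intro openin_Int E.openin_boundary_prepend[OF p'(2)] E.openin_boundary_prepend[OF q'(2)]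
        open_pre openin_boundary_map_start open_not)
  moreover have "(w', z') \<in> W"
  proof -
    have sx: "\<phi> (snd x) = seq_prepend p z" and sy: "\<phi> (snd y) = seq_prepend q z"
      using snd_boundary_map[OF xy(1)] snd_boundary_map[OF xy(2)] z by simp_all
    have "x \<in> P" "y \<in> Q" using xy sx sy z(1,2) by (simp_all add: P_def Q_def)
    moreover have "\<phi> z' = z" using snd_boundary_map[OF wz'_in] bwz' by simp
    moreover have "\<not> seq_prefix [e] z" if "e \<in> S" for e
      using z(5) that unfolding seq_prefix_def by (metis seq_first_Cons)
    ultimately show ?thesis using wz'_in bwz' p'(3) q'(3) by (auto simp: W_def)
  qed
  ultimately obtain V where V: "openin (full_shift (arcs E)) V" "z' \<in> V"
    "\<And>y. y \<in> V \<Longrightarrow> (w', y) \<in> boundary_paths E \<Longrightarrow> (w', y) \<in> W"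
    by (rule openin_boundary_topology_at) blast
  let ?T = "{((u', seq_prepend p' y), int (length p') - int (length q'), (v', seq_prepend q' y)) | y.
       (w', y) \<in> boundary_paths E \<and> y \<in> V}"
  show thesis
  proof (rule that)
    show "openin (arrow_topology (graph_groupoid E)) ?T"
      by (rule E.openin_arrow_topology_prepend[OF p'(2) q'(2) V(1)])
    show "g \<in> ?T" using g z(3) p'(1,3) q'(1,3) wz'_in V(2) by auto
    fix h assume "h \<in> ?T"
    then obtain y where h: "h = ((u', seq_prepend p' y), k, (v', seq_prepend q' y))"
      and y: "(w', y) \<in> boundary_paths E" "y \<in> V"
      using p'(1) q'(1) z(3) by auto
    have W: "(w', y) \<in> W" using V(3) y by blast
    define t where "t = snd (boundary_map (w', y))"
    have bt: "boundary_map (w', y) = (w, t)" using W by (simp add: W_def t_def prod_eq_iff)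
    have t\<phi>: "t = \<phi> y" using snd_boundary_map[OF y(1)] bt by simp
    have t_in: "(w, t) \<in> boundary_paths F" using boundary_map_in[OF y(1)] bt by simp
    have t_first: "\<forall>e. seq_first t = Some e \<longrightarrow> e \<notin> S"
      using W by (auto simp: W_def t\<phi> seq_first_eq_Some)
    \<comment> \<open>The prefix obtained for this \<open>y\<close> has the length of
      \<open>r\<close>, and the image begins with \<open>r\<close>, so the two coincide.\<close>
    have same: "boundary_map (a, seq_prepend r' y) = (a', seq_prepend r t)"
      if r': "E.awalk a r' w'" "length r' = length r"
        and "(a, seq_prepend r' y) \<in> {x \<in> boundary_paths E. seq_prefix r (\<phi> (snd x)) \<and> fst (boundary_map x) = a'}"
      for a r' a' r
    proof -
      from that(3) have bp: "(a, seq_prepend r' y) \<in> boundary_paths E"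
        and sp: "seq_prefix r (\<phi> (seq_prepend r' y))"
        and st: "fst (boundary_map (a, seq_prepend r' y)) = a'" by auto
      obtain a'' r'' where r'': "length r'' = length r'"
        "boundary_map (a, seq_prepend r' y) = (a'', seq_prepend r'' t)"
        using boundary_map_prepend[OF r'(1) y(1)] bt by (metis snd_conv)
      have "\<phi> (seq_prepend r' y) = seq_prepend r'' t" using snd_boundary_map[OF bp] r''(2) by simp
      then have "r'' = r" using sp r''(1) r'(2) seq_prefix_same_length by metis
      then show ?thesis using r''(2) st by simp
    qed
    have "boundary_map (u', seq_prepend p' y) = (u, seq_prepend p t)"
      by (rule same[OF p'(2,1)]) (use W in \<open>simp add: W_def P_def\<close>)
    moreover have "boundary_map (v', seq_prepend q' y) = (v, seq_prepend q t)"
      by (rule same[OF q'(2,1)]) (use W in \<open>simp add: W_def Q_def\<close>)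
    ultimately show "groupoid_map h \<in> C"
      using t_in t_first z(3) unfolding h C groupoid_map_def groupoid_cylinder_def by auto
  qed
qed

section \<open>Continuity of the groupoid map and the isomorphism\<close>

lemma continuous_map_groupoid_map:
  "continuous_map (arrow_topology (graph_groupoid E)) (arrow_topology (graph_groupoid F)) groupoid_map"
proof -
  have top: "\<Union>(groupoid_basis F) = graph_groupoid_arrows F"
    using arrows_graph_groupoid[of F] by (simp add: graph_groupoid_def topology_generated_by_topspace)
  have "continuous_map (arrow_topology (graph_groupoid E)) (topology_generated_by (groupoid_basis F)) groupoid_map"
  proof (rule continuous_on_generated_topo)
    fix C assume C: "C \<in> groupoid_basis F"
    show "openin (arrow_topology (graph_groupoid E)) (groupoid_map -` C \<inter> arrows (graph_groupoid E))"
    proof (subst openin_subopen, intro ballI)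
      fix g assume "g \<in> groupoid_map -` C \<inter> arrows (graph_groupoid E)"
      then have "g \<in> graph_groupoid_arrows E" "groupoid_map g \<in> C" by (auto simp: arrows_graph_groupoid)
      with C obtain T where T: "openin (arrow_topology (graph_groupoid E)) T" "g \<in> T"
        "\<And>h. h \<in> T \<Longrightarrow> groupoid_map h \<in> C" by (rule groupoid_map_open_preimage) blast
      then show "\<exists>T. openin (arrow_topology (graph_groupoid E)) T \<and> g \<in> T \<and>
          T \<subseteq> groupoid_map -` C \<inter> arrows (graph_groupoid E)"
        using openin_subset[OF T(1)] by blast
    qed
  next
    show "groupoid_map ` arrows (graph_groupoid E) \<subseteq> \<Union>(groupoid_basis F)"
      unfolding top arrows_graph_groupoid using groupoid_map_in by blast
  qed
  then show ?thesis by (simp add: graph_groupoid_def)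
qed

end

context edge_shift_conjugacy
begin

interpretation inverse: edge_shift_conjugacy F E \<psi> \<phi>
  by (rule conjugacy_sym)

lemma topological_groupoid_iso_groupoid_map:
  "topological_groupoid_iso (graph_groupoid E) (graph_groupoid F) groupoid_map"
proof -
  have "homeomorphic_maps (arrow_topology (graph_groupoid E)) (arrow_topology (graph_groupoid F))
      groupoid_map inverse.groupoid_map"
    unfolding homeomorphic_maps_def arrows_graph_groupoid
    using continuous_map_groupoid_map inverse.continuous_map_groupoid_map
      inverse_groupoid_map inverse.inverse_groupoid_map by blast
  then have "homeomorphic_map (arrow_topology (graph_groupoid E)) (arrow_topology (graph_groupoid F))
      groupoid_map"
    using homeomorphic_map_maps by blast
  \<comment> \<open>Composability is equality of the middle paths, so reflecting it requires
    injectivity of the boundary map.\<close>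
  moreover have "y = y' \<longleftrightarrow> boundary_map y = boundary_map y'"
    if "(x, k, y) \<in> graph_groupoid_arrows E" "(y', l, z) \<in> graph_groupoid_arrows E" for x k y y' l z
    using that graph_arrow_ends inverse_boundary_map by metis
  ultimately show ?thesis
    unfolding topological_groupoid_iso_def arrows_graph_groupoid
    by (auto simp: graph_groupoid_def groupoid_map_def)
qed

end

theorem theorem8p8:
  fixes E :: "('v, 'e) pre_digraph" and F :: "('w, 'f) pre_digraph"
  assumes "countable_graph E" and "countable_graph F"
    and "no_sinks E" and "no_sinks F"
    and "no_sources E" and "no_sources F"
    and "edge_shifts_conjugate E F"
  shows "isomorphic_topological_groupoids (graph_groupoid E) (graph_groupoid F)"
proof -
  obtain \<phi> where bij: "bij_betw \<phi> (edge_shift E) (edge_shift F)"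
    and cont: "continuous_map (edge_shift_topology E) (edge_shift_topology F) \<phi>"
    and shift: "\<And>x. x \<in> edge_shift E \<Longrightarrow> \<phi> (seq_shift x) = seq_shift (\<phi> x)"
    and len: "\<And>x. x \<in> edge_shift E \<Longrightarrow> seq_length (\<phi> x) = seq_length x"
    using assms(7) unfolding edge_shifts_conjugate_def by blast
  define \<psi> where "\<psi> = inv_into (edge_shift E) \<phi>"
  interpret E: wf_digraph E using assms(1) by (simp add: countable_graph_def)
  interpret F: wf_digraph F using assms(2) by (simp add: countable_graph_def)
  have \<psi>\<phi>: "\<psi> (\<phi> x) = x" if "x \<in> edge_shift E" for x
    using bij that unfolding \<psi>_def by (simp add: bij_betw_def)
  have \<psi>_in: "\<psi> y \<in> edge_shift E" and \<phi>\<psi>: "\<phi> (\<psi> y) = y" if "y \<in> edge_shift F" for y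
    using bij that unfolding \<psi>_def by (auto simp: bij_betw_def f_inv_into_f inv_into_into)
  \<comment> \<open>The relation for \<open>\<phi>\<close> is applied at \<open>\<psi> y\<close> and
    then undone by \<open>\<psi>\<close>, which requires that the edge shift is closed under the
    shift.\<close>
  have \<psi>_shift: "\<psi> (seq_shift y) = seq_shift (\<psi> y)" if "y \<in> edge_shift F" for y
    using shift[OF \<psi>_in[OF that]] \<phi>\<psi>[OF that] \<psi>\<phi> E.seq_shift_in_edge_shift[OF assms(3) \<psi>_in[OF that]]
    by metis
  have \<psi>_length: "seq_length (\<psi> y) = seq_length y" if "y \<in> edge_shift F" for y
    using len[OF \<psi>_in[OF that]] \<phi>\<psi>[OF that] by simp
  interpret edge_shift_conjugacy E F \<phi> \<psi>
    by unfold_locales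
      (use assms cont shift len \<psi>\<phi> \<phi>\<psi> \<psi>_shift \<psi>_length
        continuous_map_inverse_edge_shift[OF bij cont] in \<open>auto simp: \<psi>_def[symmetric]\<close>)
  show ?thesis
    unfolding isomorphic_topological_groupoids_def
    using topological_groupoid_iso_groupoid_map by blast
qed

end
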